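(* Let $G$ be a discrete distribution on $\{1,2,\dots,m\}$ such that $\mathbb{P}(X=1)<1$ for $X\sim G$. For each $k\in\{1,2,\dots,m\}$, let $\mathcal{F}_k$ be a finite set of good probability distributions with density functions supported on $[0,1]^{k-1}$. Start with a stick of length $L$. At each level $i$, for each stick in that level, independently choose $k\in\{1,2,\dots,m\}$ according to $G$, and break the stick into $k$ parts by cutting it at the $k-1$ coordinates of a random variable sampled from some distribution in $\mathcal{F}_k$. Then the distribution of the stick lengths at level $N$ approaches a strong Benford distribution (base $B$) almost surely as $N\to\infty$.
   Context: Fix a base $B>1$. Each $x>0$ is written uniquely as $x=S_B(x)B^{j}$ with $S_B(x)\in[1,B)$ and $j\in\mathbb{Z}$; $S_B(x)$ is the significand of $x$. A sequence of finite collections of positive numbers $\mathcal{A}_n=\{a_{n,i}\}$ (counted with multiplicity) converges to strong Benford behavior (base $B$) if $\lim_{n\to\infty}\#\{i:1\le S_B(a_{n,i})\le s\}/|\mathcal{A}_n|=\log_B s$ for all $s\in[1,B)$. "Almost surely" means that, with probability 1, the realized collections of stick lengths present after $N$ levels converge to strong Benford behavior in this sense as $N\to\infty$. Good distributions: let $\mathcal{D}$ be a probability distribution on $\mathbb{R}^d$ supported on $[0,1]^d$. For $X\sim\mathcal{D}$ let $\mathrm{rk}_i(X)$ be its $i$-th smallest coordinate ($1\le i\le d$), $\mathrm{rk}_0(X)=0$, $\mathrm{rk}_{d+1}(X)=1$. $\mathcal{D}$ is good if $\mathrm{rk}_{i+1}(X)-\mathrm{rk}_i(X)$ has Hölder continuous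 density for all $0\le i\le d$. The coordinates are relative cut positions: cutting a stick of length $\ell$ at $X\in[0,1]^{k-1}$ produces $k$ sticks of lengths $\ell(\mathrm{rk}_{i+1}(X)-\mathrm{rk}_i(X))$, $0\le i\le k-1$. Each breaking of a stick uses a newly sampled random variable. When $k=1$ there are no cut points, the stick is left unbroken, and the goodness condition is vacuous. *)

theory Defs
  imports "HOL-Probability.Probability" "HOL-Library.Multiset"
begin

definition significand :: "real \<Rightarrow> real \<Rightarrow> real" where
  "significand B x = (THE s. 1 \<le> s \<and> s < B \<and> (\<exists>j::int. x = s * B powi j))"

definition strong_benford :: "real \<Rightarrow> (nat \<Rightarrow> real multiset) \<Rightarrow> bool" where
  "strong_benford B A \<longleftrightarrow>
     (\<forall>n. \<forall>x \<in># A n. 0 < x) \<and>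
     (\<forall>s \<in> {1..<B}.
        (\<lambda>n. real (size {#x \<in># A n. 1 \<le> significand B x \<and> significand B x \<le> s#})
              / real (size (A n))) \<longlonglongrightarrow> log B s)"

text \<open>A point of \<open>\<real>\<^sup>d\<close> is a function on \<^typ>\<open>nat\<close> of which only the coordinates below
  \<open>d\<close> are used; \<open>rk d x i\<close> is its \<open>i\<close>-th smallest coordinate for \<open>1 \<le> i \<le> d\<close>.\<close>

definition rk :: "nat \<Rightarrow> (nat \<Rightarrow> real) \<Rightarrow> nat \<Rightarrow> real" where
  "rk d x i = (if i = 0 then 0 else if i \<le> d then sort (map x [0..<d]) ! (i - 1) else 1)"

definition gap :: "nat \<Rightarrow> (nat \<Rightarrow> real) \<Rightarrow> nat \<Rightarrow> real" where
  "gap d x i = rk d x (Suc i) - rk d x i"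

definition holder_on :: "real set \<Rightarrow> (real \<Rightarrow> real) \<Rightarrow> bool" where
  "holder_on S f \<longleftrightarrow> (\<exists>C \<alpha>. 0 < \<alpha> \<and> \<alpha> \<le> 1 \<and>
     (\<forall>x\<in>S. \<forall>y\<in>S. \<bar>f x - f y\<bar> \<le> C * \<bar>x - y\<bar> powr \<alpha>))"

text \<open>Gaps take values in \<open>[0,1]\<close>, and their density is only required to be Hoelder continuous
  on that interval; it may jump at the end points when it is extended by \<open>0\<close>.  (For a uniform
  cut point both gaps have density \<open>1\<close> on \<open>[0,1]\<close>.)  For \<open>d = 0\<close> the only gap is
  constantly \<open>1\<close>, and there is no condition.\<close>

definition good_distribution :: "nat \<Rightarrow> (nat \<Rightarrow> real) measure \<Rightarrow> bool" where
  "good_distribution d P \<longleftrightarrow>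
     prob_space P \<and> sets P = sets (PiM {..<d} (\<lambda>_. borel)) \<and>
     (AE x in P. \<forall>j<d. x j \<in> {0..1}) \<and>
     (0 < d \<longrightarrow>
       (\<forall>i\<le>d. \<exists>f. holder_on {0..1} f \<and> (\<forall>t\<in>{0..1}. 0 \<le> f t) \<and>
          distributed P lborel (\<lambda>x. gap d x i) (\<lambda>t. ennreal (indicator {0..1} t * f t))))"

definition has_density_on_cube :: "nat \<Rightarrow> (nat \<Rightarrow> real) measure \<Rightarrow> bool" where
  "has_density_on_cube d P \<longleftrightarrow>
     (\<exists>f \<in> borel_measurable (PiM {..<d} (\<lambda>_. lborel)).
        (\<forall>x. f x \<noteq> 0 \<longrightarrow> (\<forall>j<d. x j \<in> {0..1})) \<and>
        P = density (PiM {..<d} (\<lambda>_. lborel)) f)"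

text \<open>Sticks are addressed by lists: the original stick is \<open>[]\<close>, and \<open>i # v\<close> is the
  \<open>i\<close>-th piece, from left to right and counting from \<open>0\<close>, of the stick \<open>v\<close>.  The stick
  \<open>v\<close> is broken into \<open>\<kappa> v\<close> pieces at the first \<open>\<kappa> v - 1\<close> coordinates of \<open>x v\<close>.\<close>

primrec sticks :: "(nat list \<Rightarrow> nat) \<Rightarrow> nat \<Rightarrow> nat list set" where
  "sticks \<kappa> 0 = {[]}"
| "sticks \<kappa> (Suc N) = {i # v |i v. v \<in> sticks \<kappa> N \<and> i < \<kappa> v}"

primrec stick_length ::
    "real \<Rightarrow> (nat list \<Rightarrow> nat) \<Rightarrow> (nat list \<Rightarrow> nat \<Rightarrow> real) \<Rightarrow> nat list \<Rightarrow> real" where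
  "stick_length L \<kappa> x [] = L"
| "stick_length L \<kappa> x (i # v) = stick_length L \<kappa> x v * gap (\<kappa> v - 1) (x v) i"

definition stick_lengths ::
    "real \<Rightarrow> (nat list \<Rightarrow> nat) \<Rightarrow> (nat list \<Rightarrow> nat \<Rightarrow> real) \<Rightarrow> nat \<Rightarrow> real multiset" where
  "stick_lengths L \<kappa> x N = image_mset (stick_length L \<kappa> x) (mset_set (sticks \<kappa> N))"

text \<open>The random data of the process: \<open>K v\<close> is the number of pieces of the stick \<open>v\<close>,
  \<open>D v\<close> the member of \<open>F (K v)\<close> selected for it and \<open>X v\<close> its cut vector.  How the
  distributions are selected is left open: the selection may be deterministic or random and may
  depend on the address of the stick and on all the numbers of pieces.  The last assumption says
  that, given the numbers of pieces and the selected distributions, the cut vectors are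
  independent and each of them follows its selected distribution; in particular neither the
  numbers of pieces nor the selection react to the cuts.\<close>

locale stick_breaking = prob_space M for M :: "'w measure" +
  fixes G :: "nat pmf"
    and F :: "nat \<Rightarrow> (nat \<Rightarrow> real) measure set"
    and K :: "nat list \<Rightarrow> 'w \<Rightarrow> nat"
    and D :: "nat list \<Rightarrow> 'w \<Rightarrow> (nat \<Rightarrow> real) measure"
    and X :: "nat list \<Rightarrow> 'w \<Rightarrow> nat \<Rightarrow> real"
  assumes K_indep: "indep_vars (\<lambda>_. count_space UNIV) K UNIV"
    and K_distr: "\<And>v. distr M (count_space UNIV) (K v) = measure_pmf G"
    and D_measurable: "\<And>v. random_variable (count_space UNIV) (D v)"
    and D_selected: "AE \<omega> in M. \<forall>v. D v \<omega> \<in> F (K v \<omega>)"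
    and X_measurable: "\<And>v. random_variable (PiM UNIV (\<lambda>_. borel)) (X v)"
    and X_conditional: "\<And>V \<kappa> \<delta> A. finite V \<Longrightarrow>
      (\<And>v. v \<in> V \<Longrightarrow> \<delta> v \<in> F (\<kappa> v) \<and> A v \<in> sets (\<delta> v)) \<Longrightarrow>
      prob {\<omega> \<in> space M. \<forall>v\<in>V. K v \<omega> = \<kappa> v \<and> D v \<omega> = \<delta> v \<and>
                              restrict (X v \<omega>) {..<\<kappa> v - 1} \<in> A v}
      = prob {\<omega> \<in> space M. \<forall>v\<in>V. K v \<omega> = \<kappa> v \<and> D v \<omega> = \<delta> v}
        * (\<Prod>v\<in>V. measure (\<delta> v) (A v))"

end

theory Submission
  imports Defs
begin

text \<open>
  By Weyl's criterion it is enough that, for every integer \<open>h \<noteq> 0\<close> and \<open>\<theta> = 2 \<pi> h / ln B\<close>,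
  almost surely the average of \<open>\<ell>\<^sub>v powr (i \<theta>)\<close> over the \<open>N\<^sub>n\<close> sticks \<open>v\<close> of level \<open>n\<close> tends to
  \<open>0\<close>.  There are countably many \<open>h\<close>, so one of them may be fixed.

  Second moment, given the tree.  Condition on all numbers of pieces and all selected
  distributions.  Then \<open>\<ell>\<^sub>v powr (i \<theta>)\<close> is a product of independent factors along the path from the
  root to \<open>v\<close>.  In the product for \<open>v\<close> times the conjugate of the product for \<open>w\<close>, everything above the last
  common ancestor cancels.  Every later vertex on the way to \<open>v\<close> that is broken into at least two
  pieces contributes a factor of modulus at most \<open>\<rho> < 1\<close>, because a gap with a density does not
  concentrate on one coset of a lattice on the logarithmic scale
  (\<open>good_distribution_osc\<close>, \<open>uniform_oscillation_bound\<close>).  Hence the conditional second moment of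
  the average is at most the mean over all pairs \<open>(v, w)\<close> of \<open>\<rho>\<close> to the number of those vertices, a
  functional of the tree alone: \<open>correlation\<close>
  (\<open>prod_phase_factors_le_pair_weight\<close>, \<open>second_moment_history\<close>).

  Decay of the correlation.  The normalisation by the random number \<open>N\<^sub>n\<close> prevents a direct
  computation of expectations, since large families weigh more.  Exchangeability resolves this.
  Given the first \<open>n\<close> levels, the next numbers of pieces are i.i.d., so each ordered pair of
  distinct sticks receives the same expected share of the pairs of the next level, with or without
  damping.  Summed over all pairs, the damped share is at most \<open>\<gamma> = 1 - (1 - \<rho>) p\<close>, where \<open>p\<close> is
  the probability of at least two pieces: families with at least two pieces hold at least as large
  a share of the next level as of the present one.  The same comparison gives
  \<open>E (1 / N\<^sub>n) \<le> (1 - p / 2) ^ n\<close>.  Pairs of siblings cost at most \<open>m / N\<^sub>n\<close>, so the expected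
  correlation \<open>e\<^sub>n\<close> satisfies \<open>e\<^sub>n\<^sub>+\<^sub>1 \<le> \<gamma> e\<^sub>n + O (E (1 / N\<^sub>n))\<close> and decays geometrically
  (\<open>summable_expectation_correlation\<close>).

  The expected squared averages are therefore summable over \<open>n\<close>, which makes the averages
  themselves tend to \<open>0\<close> almost surely.
\<close>

section \<open>Weyl's criterion\<close>

text \<open>On the unit circle the conjugate of \<open>z\<close> is \<open>1 / z\<close>, so the two coordinate functions are Laurent
  polynomials in \<open>z\<close>.  These are closed under addition and multiplication, which lets the real
  Stone-Weierstrass theorem provide trigonometric approximations.\<close>

lemma real_polynomial_function_circle:
  fixes f :: "complex \<Rightarrow> real"
  assumes "real_polynomial_function f"
  shows "\<exists>c H. finite H \<and> (\<forall>z. norm z = 1 \<longrightarrow> of_real (f z) = (\<Sum>h\<in>H. c h * z powi (h::int)))"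
  using assms
proof (induction rule: real_polynomial_function.induct)
  case (linear f)
  \<comment> \<open>The coefficients come from \<open>Re z = (z + 1 / z) / 2\<close> and \<open>Im z = (z - 1 / z) / (2 i)\<close>.\<close>
  let ?c = "\<lambda>h::int. if h = 1 then Complex (f 1 / 2) (- f \<i> / 2) else Complex (f 1 / 2) (f \<i> / 2)"
  show ?case
  proof (intro exI conjI allI impI)
    show "finite {1, -1::int}" by simp
    fix z :: complex assume z: "norm z = 1"
    have "z = Re z *\<^sub>R 1 + Im z *\<^sub>R \<i>" by (simp add: complex_eq_iff)
    then have "f z = Re z * f 1 + Im z * f \<i>"
      using linear_add[OF bounded_linear.linear[OF linear]] linear_scale[OF bounded_linear.linear[OF linear]]
      by (metis real_scaleR_def)
    moreover have "inverse z = cnj z"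
      using z complex_norm_square[of z] by (intro inverse_unique) simp
    ultimately show "complex_of_real (f z) = (\<Sum>h\<in>{1, -1::int}. ?c h * z powi h)"
      by (simp add: complex_eq_iff power_int_minus)
  qed
next
  case (const c)
  show ?case
    by (rule exI[of _ "\<lambda>_. of_real c"], rule exI[of _ "{0}"]) simp
next
  case (add f g)
  then obtain c H d K where H: "finite H" "finite K"
    and f: "\<And>z. norm z = 1 \<Longrightarrow> of_real (f z) = (\<Sum>h\<in>H. c h * z powi (h::int))"
    and g: "\<And>z. norm z = 1 \<Longrightarrow> of_real (g z) = (\<Sum>h\<in>K. d h * z powi (h::int))"
    by blast
  let ?e = "\<lambda>h. (if h \<in> H then c h else 0) + (if h \<in> K then d h else 0)"
  show ?case
  proof (intro exI conjI allI impI)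
    show "finite (H \<union> K)" using H by simp
    fix z :: complex assume z: "norm z = 1"
    have "(\<Sum>h\<in>H. c h * z powi h) = (\<Sum>h\<in>H \<union> K. (if h \<in> H then c h else 0) * z powi h)"
      using H by (intro sum.mono_neutral_cong_left) auto
    moreover have "(\<Sum>h\<in>K. d h * z powi h) = (\<Sum>h\<in>H \<union> K. (if h \<in> K then d h else 0) * z powi h)"
      using H by (intro sum.mono_neutral_cong_left) auto
    ultimately show "complex_of_real (f z + g z) = (\<Sum>h\<in>H \<union> K. ?e h * z powi h)"
      using f[OF z] g[OF z] by (simp add: sum.distrib distrib_right)
  qed
next
  case (mult f g)
  then obtain c H d K where H: "finite H" "finite K"
    and f: "\<And>z. norm z = 1 \<Longrightarrow> of_real (f z) = (\<Sum>h\<in>H. c h * z powi (h::int))"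
    and g: "\<And>z. norm z = 1 \<Longrightarrow> of_real (g z) = (\<Sum>h\<in>K. d h * z powi (h::int))"
    by blast
  let ?s = "\<lambda>(h,k). h + k :: int"
  let ?e = "\<lambda>j. \<Sum>p\<in>{p\<in>H \<times> K. ?s p = j}. c (fst p) * d (snd p)"
  show ?case
  proof (intro exI conjI allI impI)
    show "finite (?s ` (H \<times> K))" using H by simp
    fix z :: complex assume z: "norm z = 1"
    then have z0: "z \<noteq> 0" by auto
    have "complex_of_real (f z * g z) = (\<Sum>p\<in>H\<times>K. c (fst p) * d (snd p) * z powi (?s p))"
      using z0 by (simp add: f[OF z] g[OF z] sum_product sum.cartesian_product power_int_add
          case_prod_beta mult_ac)
    also have "\<dots> = (\<Sum>j\<in>?s ` (H \<times> K). \<Sum>p\<in>{p\<in>H \<times> K. ?s p = j}. c (fst p) * d (snd p) * z powi (?s p))"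
      using H by (intro sum.image_gen) auto
    also have "\<dots> = (\<Sum>j\<in>?s ` (H \<times> K). ?e j * z powi j)"
      by (auto intro!: sum.cong simp: sum_distrib_right)
    finally show "complex_of_real (f z * g z) = (\<Sum>j\<in>?s ` (H \<times> K). ?e j * z powi j)" .
  qed
qed

definition circle :: "real \<Rightarrow> complex" where "circle x = cis (2 * pi * x)"

lemma norm_circle [simp]: "norm (circle x) = 1"
  by (simp add: circle_def)

lemma circle_powi: "circle x powi h = cis (2 * pi * of_int h * x)"
  by (simp add: circle_def cis_power_int mult_ac)

lemma circle_frac: "circle (frac x) = circle x"
proof -
  have "circle x = circle (frac x) * circle (of_int \<lfloor>x\<rfloor>)"
    by (simp add: circle_def cis_mult frac_def algebra_simps)
  moreover have "circle (of_int \<lfloor>x\<rfloor>) = 1"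
    using cis_multiple_2pi[of "of_int \<lfloor>x\<rfloor>"] by (simp add: circle_def)
  ultimately show ?thesis by simp
qed

lemma circle_eq_imp:
  assumes "circle x = circle y" "0 \<le> x" "x \<le> 1" "0 \<le> y" "y \<le> 1"
  shows "x = y \<or> {x, y} = {0, 1}"
proof -
  have "sin (2*pi*x) = sin (2*pi*y) \<and> cos (2*pi*x) = cos (2*pi*y)"
    using assms(1) by (simp add: circle_def complex_eq_iff)
  then obtain n :: int where "2 * pi * x = 2 * pi * y + 2 * pi * of_int n" 
    using sin_cos_eq_iff[of "2*pi*x" "2*pi*y"] by auto
  then have "2 * pi * x = 2 * pi * (y + of_int n)" by (simp add: algebra_simps)
  then have n: "x = y + of_int n" using pi_gt_zero by (metis less_irrefl mult_cancel_left mult_eq_0_iff zero_neq_numeral)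
  then have "of_int n \<le> (1::real)" "(-1::real) \<le> of_int n" using assms by linarith+
  then have "n = -1 \<or> n = 0 \<or> n = 1" by linarith
  then show ?thesis using n assms by auto
qed

lemma continuous_on_circle: "continuous_on S circle"
  unfolding circle_def by (intro continuous_intros)

lemma has_integral_circle_powi:
  "((\<lambda>x. circle x powi h) has_integral (if h = 0 then 1 else 0)) {0..1}"
proof (cases "h = 0")
  case True
  then show ?thesis using has_integral_const_real[of "1::complex" 0 1] by simp
next
  case False
  let ?w = "2 * pi * of_int h"
  have "((\<lambda>x. cis (?w * x)) has_integral (cis (?w * 1) / (\<i> * ?w) - cis (?w * 0) / (\<i> * ?w))) {0..1}"
  proof (rule fundamental_theorem_of_calculus)
    fix x :: real
    have "((\<lambda>z. exp (\<i> * of_real ?w * z) / (\<i> * ?w)) has_field_derivative cis (?w * x)) (at (of_real x))"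
      using False by (auto intro!: derivative_eq_intros simp: cis_conv_exp mult_ac)
    then have "((\<lambda>x. exp (\<i> * of_real ?w * of_real x) / (\<i> * ?w)) has_vector_derivative cis (?w * x)) (at x within {0..1})"
      by (rule has_vector_derivative_real_field)
    then show "((\<lambda>x. cis (?w * x) / (\<i> * ?w)) has_vector_derivative cis (?w * x)) (at x within {0..1})"
      by (simp add: cis_conv_exp mult_ac)
  qed simp
  moreover have "cis (?w * 1) = 1" using cis_multiple_2pi[of "of_int h"] by simp
  ultimately show ?thesis using False by (simp add: circle_powi)
qed

definition average :: "real multiset \<Rightarrow> (real \<Rightarrow> 'a) \<Rightarrow> 'a::real_normed_field" where
  "average A f = (\<Sum>x\<in>#A. f x) / of_nat (size A)"

lemma average_mono:
  assumes "\<And>x. x \<in># A \<Longrightarrow> f x \<le> g x"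
  shows "average A f \<le> average A (g :: real \<Rightarrow> real)"
  unfolding average_def using assms by (intro divide_right_mono sum_mset_mono) auto

lemma average_cong: "(\<And>x. x \<in># A \<Longrightarrow> f x = g x) \<Longrightarrow> average A f = average A g"
  unfolding average_def by (metis image_mset_cong)

lemma average_const: "A \<noteq> {#} \<Longrightarrow> average A (\<lambda>_. c) = c"
  by (simp add: average_def)

lemma average_add: "average A (\<lambda>x. f x + g x) = average A f + average A g"
  by (simp add: average_def add_divide_distrib sum_mset.distrib)

lemma average_cmult: "average A (\<lambda>x. c * f x) = c * average A f"
  by (simp add: average_def sum_mset_distrib_left)

lemma average_sum: "finite H \<Longrightarrow> average A (\<lambda>x. \<Sum>h\<in>H. f h x) = (\<Sum>h\<in>H. average A (f h))"
  by (induction H rule: finite_induct) (simp_all add: average_add, simp add: average_def)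

lemma average_of_real: "average A (\<lambda>x. complex_of_real (f x)) = of_real (average A f)"
proof -
  have "(\<Sum>x\<in>#A. complex_of_real (f x)) = of_real (\<Sum>x\<in>#A. f x)"
    by (induction A) auto
  then show ?thesis by (simp add: average_def)
qed

text \<open>Both the averages and the integral keep only the coefficient of \<open>z powi 0\<close> in the limit.\<close>

lemma average_circle_polynomial_tendsto:
  fixes A :: "nat \<Rightarrow> real multiset" and f :: "complex \<Rightarrow> real"
  assumes ne: "\<And>n. A n \<noteq> {#}"
    and lim: "\<And>h::int. h \<noteq> 0 \<Longrightarrow> (\<lambda>n. average (A n) (\<lambda>x. circle x powi h)) \<longlonglongrightarrow> 0"
    and f: "real_polynomial_function f"
  shows "(\<lambda>n. average (A n) (\<lambda>x. f (circle x))) \<longlonglongrightarrow> integral {0..1} (\<lambda>x. f (circle x))"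
proof -
  obtain c H where H: "finite H"
    and feq: "\<And>z. norm z = 1 \<Longrightarrow> of_real (f z) = (\<Sum>h\<in>H. c h * z powi (h::int))"
    using real_polynomial_function_circle[OF f] by blast
  let ?d = "\<lambda>h::int. if h = 0 then 1 else 0 :: complex"
  have "(\<lambda>n. average (A n) (\<lambda>x. circle x powi h)) \<longlonglongrightarrow> ?d h" for h
    using lim[of h] by (cases "h = 0") (simp_all add: average_const ne)
  then have "(\<lambda>n. \<Sum>h\<in>H. c h * average (A n) (\<lambda>x. circle x powi h)) \<longlonglongrightarrow> (\<Sum>h\<in>H. c h * ?d h)"
    by (intro tendsto_sum tendsto_mult tendsto_const)
  also have "(\<lambda>n. \<Sum>h\<in>H. c h * average (A n) (\<lambda>x. circle x powi h))
      = (\<lambda>n. complex_of_real (average (A n) (\<lambda>x. f (circle x))))"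
    by (simp add: average_of_real[symmetric] feq average_sum H average_cmult)
  finally have 1: "(\<lambda>n. complex_of_real (average (A n) (\<lambda>x. f (circle x)))) \<longlonglongrightarrow> (\<Sum>h\<in>H. c h * ?d h)" .
  have "((\<lambda>x. \<Sum>h\<in>H. c h * circle x powi h) has_integral (\<Sum>h\<in>H. c h * ?d h)) {0..1}"
    by (intro has_integral_sum H has_integral_mult_right has_integral_circle_powi)
  then have 2: "((\<lambda>x. complex_of_real (f (circle x))) has_integral (\<Sum>h\<in>H. c h * ?d h)) {0..1}"
    by (simp add: feq)
  have 3: "((\<lambda>x. f (circle x)) has_integral Re (\<Sum>h\<in>H. c h * ?d h)) {0..1}"
    using has_integral_linear[OF 2 bounded_linear_Re] by (simp add: o_def)
  show ?thesis
    using tendsto_Re[OF 1] integral_unique[OF 3] by simp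
qed

lemma average_circle_continuous_tendsto:
  fixes A :: "nat \<Rightarrow> real multiset" and f :: "complex \<Rightarrow> real"
  assumes ne: "\<And>n. A n \<noteq> {#}"
    and lim: "\<And>h::int. h \<noteq> 0 \<Longrightarrow> (\<lambda>n. average (A n) (\<lambda>x. circle x powi h)) \<longlonglongrightarrow> 0"
    and f: "continuous_on UNIV f"
  shows "(\<lambda>n. average (A n) (\<lambda>x. f (circle x))) \<longlonglongrightarrow> integral {0..1} (\<lambda>x. f (circle x))"
proof (rule tendstoI)
  fix e :: real assume "0 < e"
  then have e: "0 < e / 3" by simp
  obtain g where g: "real_polynomial_function g"
    and fg: "\<And>z. z \<in> sphere 0 1 \<Longrightarrow> \<bar>f z - g z\<bar> < e / 3"
    using Stone_Weierstrass_real_polynomial_function[OF compact_sphere continuous_on_subset[OF f subset_UNIV] e]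
    by metis
  have fg': "\<bar>f (circle x) - g (circle x)\<bar> < e / 3" for x
    using fg[of "circle x"] by simp
  have avg: "\<bar>average (A n) (\<lambda>x. f (circle x)) - average (A n) (\<lambda>x. g (circle x))\<bar> \<le> e / 3" for n
  proof -
    have "average (A n) (\<lambda>x. f (circle x)) \<le> average (A n) (\<lambda>x. g (circle x) + e / 3)"
      by (rule average_mono) (use fg' in \<open>smt (verit)\<close>)
    moreover have "average (A n) (\<lambda>x. g (circle x)) \<le> average (A n) (\<lambda>x. f (circle x) + e / 3)"
      by (rule average_mono) (use fg' in \<open>smt (verit)\<close>)
    ultimately show ?thesis
      using ne[of n] unfolding average_add by (simp only: average_const not_False_eq_True abs_le_iff) linarith
  qed
  have fi: "(\<lambda>x. f (circle x)) integrable_on {0..1}"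
    by (intro integrable_continuous_interval continuous_on_compose2[OF f continuous_on_circle]) simp
  have gi: "(\<lambda>x. g (circle x)) integrable_on {0..1}"
    by (intro integrable_continuous_interval continuous_on_compose2[OF continuous_on_polymonial_function[of _ UNIV] continuous_on_circle])
       (use g in \<open>auto simp: real_polynomial_function_eq\<close>)
  have int: "\<bar>integral {0..1} (\<lambda>x. f (circle x)) - integral {0..1} (\<lambda>x. g (circle x))\<bar> \<le> e / 3"
  proof -
    have "norm (integral {0..1} (\<lambda>x. f (circle x) - g (circle x))) \<le> integral {0..1} (\<lambda>x::real. e / 3)"
      by (intro integral_norm_bound_integral integrable_diff fi gi integrable_const_ivl)
         (use fg' in \<open>auto intro: less_imp_le\<close>)
    then show ?thesis by (simp add: integral_diff fi gi)
  qed
  have "\<forall>\<^sub>F n in sequentially. dist (average (A n) (\<lambda>x. g (circle x))) (integral {0..1} (\<lambda>x. g (circle x))) < e / 3"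
    using average_circle_polynomial_tendsto[OF ne lim g] e by (rule tendstoD)
  then show "\<forall>\<^sub>F n in sequentially. dist (average (A n) (\<lambda>x. f (circle x))) (integral {0..1} (\<lambda>x. f (circle x))) < e"
  proof eventually_elim
    case (elim n)
    then show ?case using avg[of n] int unfolding dist_real_def by linarith
  qed
qed

definition proportion :: "real multiset \<Rightarrow> (real \<Rightarrow> bool) \<Rightarrow> real" where
  "proportion A P = real (size {#x \<in># A. P x#}) / real (size A)"

lemma proportion_eq_average: "proportion A P = average A (\<lambda>x. of_bool (P x))"
proof -
  have "real (size {#x \<in># A. P x#}) = (\<Sum>x\<in>#A. of_bool (P x))"
    by (induction A) auto
  then show ?thesis by (simp add: proportion_def average_def)
qed

lemma proportion_not:
  assumes "A \<noteq> {#}" shows "proportion A (\<lambda>x. \<not> P x) = 1 - proportion A P"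
proof -
  have "average A (\<lambda>x. of_bool (P x) + of_bool (\<not> P x)) = (1::real)"
    by (subst average_cong[where g = "\<lambda>_. 1"]) (auto simp: average_const assms)
  then show ?thesis by (simp add: proportion_eq_average average_add)
qed

lemma proportion_mono:
  assumes "\<And>x. x \<in># A \<Longrightarrow> P x \<Longrightarrow> Q x" shows "proportion A P \<le> proportion A Q"
  unfolding proportion_eq_average by (rule average_mono) (use assms in auto)

lemma integral_le_if_zero_between:
  fixes f :: "real \<Rightarrow> real"
  assumes f: "continuous_on {0..1} f" "\<And>x. f x \<le> 1" "\<And>x. x \<in> {a..b} \<Longrightarrow> f x = 0"
    and ab: "0 \<le> a" "a \<le> b" "b \<le> 1"
  shows "integral {0..1} f \<le> 1 - (b - a)"
proof -
  have int: "f integrable_on {u..v}" if "0 \<le> u" "v \<le> 1" for u v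
    using that f(1) by (intro integrable_continuous_interval continuous_on_subset[OF f(1)]) auto
  have le: "integral {u..v} f \<le> v - u" if "0 \<le> u" "u \<le> v" "v \<le> 1" for u v
    using integral_le[OF int integrable_const_ivl, of u v 1] f(2) that by simp
  have "integral {a..b} f = 0"
    using f(3) by (subst integral_cong[where g = "\<lambda>_. 0"]) auto
  moreover have "integral {0..a} f + integral {a..1} f = integral {0..1} f"
    using ab by (intro Henstock_Kurzweil_Integration.integral_combine int) auto
  moreover have "integral {a..b} f + integral {b..1} f = integral {a..1} f"
    using ab by (intro Henstock_Kurzweil_Integration.integral_combine int) auto
  ultimately show ?thesis using le[of 0 a] le[of b 1] ab by simp
qed

text \<open>A Urysohn function separating the two arcs dominates the indicator of the first arc and has
  integral at most \<open>1 - (b - a)\<close>.  Used for an arc and for its complement, this one-sided bound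
  yields both halves of the limit.\<close>

lemma eventually_proportion_less:
  fixes A :: "nat \<Rightarrow> real multiset"
  assumes ne: "\<And>n. A n \<noteq> {#}"
    and lim: "\<And>h::int. h \<noteq> 0 \<Longrightarrow> (\<lambda>n. average (A n) (\<lambda>x. circle x powi h)) \<longlonglongrightarrow> 0"
    and ab: "0 \<le> a" "a \<le> b" "b \<le> 1"
    and disj: "circle ` {p..q} \<inter> circle ` {a..b} = {}"
    and e: "1 - (b - a) < e"
  shows "\<forall>\<^sub>F n in sequentially. proportion (A n) (\<lambda>x. frac x \<in> {p..q}) < e"
proof -
  have closed: "closed (circle ` {u..v})" for u v
    by (intro compact_imp_closed compact_continuous_image continuous_on_circle) simp
  obtain f :: "complex \<Rightarrow> real" where f: "continuous_on UNIV f"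
    and seg: "\<And>z. f z \<in> closed_segment 1 0"
    and 1: "\<And>z. z \<in> circle ` {p..q} \<Longrightarrow> f z = 1" and 0: "\<And>z. z \<in> circle ` {a..b} \<Longrightarrow> f z = 0"
    using Urysohn[OF closed closed disj] by metis
  have f01: "0 \<le> f z" "f z \<le> 1" for z
    using seg[of z] by (auto simp: closed_segment_eq_real_ivl)
  have "integral {0..1} (\<lambda>x. f (circle x)) \<le> 1 - (b - a)"
    using ab f01 0
    by (intro integral_le_if_zero_between continuous_on_compose2[OF f continuous_on_circle]) auto
  then have "\<forall>\<^sub>F n in sequentially. average (A n) (\<lambda>x. f (circle x)) < e"
    using average_circle_continuous_tendsto[OF ne lim f] e order_tendstoD(2) by (metis le_less_trans)
  moreover have "proportion (A n) (\<lambda>x. frac x \<in> {p..q}) \<le> average (A n) (\<lambda>x. f (circle x))" for n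
    unfolding proportion_eq_average
  proof (rule average_mono)
    fix x
    have "f (circle x) = 1" if "frac x \<in> {p..q}"
      using 1[OF imageI[OF that]] by (simp add: circle_frac)
    then show "of_bool (frac x \<in> {p..q}) \<le> f (circle x)" using f01 by (auto simp: of_bool_def)
  qed
  ultimately show ?thesis
    using le_less_trans by (elim eventually_mono) blast
qed

text \<open>Upper bound: separate the arc \<open>{0..t}\<close> from \<open>{t + d..1 - d}\<close>.  Lower bound: separate \<open>{t..1}\<close>
  from \<open>{d..t - d}\<close> and pass to complements.  The margins \<open>d\<close> also keep the arcs apart at the
  point where \<open>0\<close> and \<open>1\<close> are glued.\<close>

theorem weyl_criterion:
  fixes A :: "nat \<Rightarrow> real multiset"
  assumes ne: "\<And>n. A n \<noteq> {#}"
    and lim: "\<And>h::int. h \<noteq> 0 \<Longrightarrow> (\<lambda>n. average (A n) (\<lambda>x. circle x powi h)) \<longlonglongrightarrow> 0"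
    and t: "0 \<le> t" "t < 1"
  shows "(\<lambda>n. proportion (A n) (\<lambda>x. frac x \<le> t)) \<longlonglongrightarrow> t"
proof (rule order_tendstoI)
  fix u assume u: "t < u"
  define d where "d = min ((u - t) / 3) ((1 - t) / 3)"
  have d: "0 < d" "3 * d \<le> u - t" "3 * d \<le> 1 - t" using u t by (auto simp: d_def min_def)
  have "circle ` {0..t} \<inter> circle ` {t + d..1 - d} = {}"
  proof -
    have False if "circle x = circle y" "x \<in> {0..t}" "y \<in> {t + d..1 - d}" for x y
      using circle_eq_imp[of x y] that d t by (auto simp: doubleton_eq_iff)
    then show ?thesis by blast
  qed
  then have "\<forall>\<^sub>F n in sequentially. proportion (A n) (\<lambda>x. frac x \<in> {0..t}) < u"
    using d t by (intro eventually_proportion_less[OF ne lim, of "t + d" "1 - d"]) auto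
  then show "\<forall>\<^sub>F n in sequentially. proportion (A n) (\<lambda>x. frac x \<le> t) < u"
    by (simp add: frac_ge_0)
next
  fix u assume u: "u < t"
  show "\<forall>\<^sub>F n in sequentially. u < proportion (A n) (\<lambda>x. frac x \<le> t)"
  proof (cases "u < 0")
    case True
    then show ?thesis
      by (intro always_eventually allI) (auto simp: proportion_def intro: less_le_trans)
  next
    case False
    define d where "d = (t - u) / 4"
    have d: "0 < d" "4 * d = t - u" "4 * d \<le> t" using u False by (auto simp: d_def)
    have "circle ` {t..1} \<inter> circle ` {d..t - d} = {}"
    proof -
      have False if "circle x = circle y" "x \<in> {t..1}" "y \<in> {d..t - d}" for x y
        using circle_eq_imp[of x y] that d t by (auto simp: doubleton_eq_iff)
      then show ?thesis by blast
    qed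
    then have "\<forall>\<^sub>F n in sequentially. proportion (A n) (\<lambda>x. frac x \<in> {t..1}) < 1 - u"
      using d t by (intro eventually_proportion_less[OF ne lim, of d "t - d"]) auto
    then show ?thesis
    proof eventually_elim
      case (elim n)
      have "proportion (A n) (\<lambda>x. \<not> frac x \<le> t) \<le> proportion (A n) (\<lambda>x. frac x \<in> {t..1})"
        by (rule proportion_mono) (auto simp: less_imp_le[OF frac_lt_1])
      then show ?case using elim by (simp add: proportion_not ne)
    qed
  qed
qed

section \<open>Significands\<close>

lemma significand_eq:
  assumes "1 < B" "0 < x" shows "significand B x = B powr frac (log B x)"
  unfolding significand_def
proof (rule the_equality)
  have "x = B powr (frac (log B x) + of_int \<lfloor>log B x\<rfloor>)"
    using assms by (simp add: frac_def)
  also have "\<dots> = B powr frac (log B x) * B powi \<lfloor>log B x\<rfloor>"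
    using assms by (simp add: powr_add powr_real_of_int')
  finally have "x = B powr frac (log B x) * B powi \<lfloor>log B x\<rfloor>" .
  moreover have "B powr frac (log B x) < B powr 1"
    using assms frac_lt_1 by (intro powr_less_mono) auto
  ultimately show "1 \<le> B powr frac (log B x) \<and> B powr frac (log B x) < B \<and> (\<exists>j. x = B powr frac (log B x) * B powi j)"
    using assms by (auto intro: ge_one_powr_ge_zero)
next
  fix s assume s: "1 \<le> s \<and> s < B \<and> (\<exists>j::int. x = s * B powi j)"
  then obtain j :: int where x: "x = s * B powi j" by blast
  have "log B x = log B s + of_int j"
    using assms s by (simp add: x log_mult powr_real_of_int'[symmetric])
  moreover have "0 \<le> log B s" "log B s < 1"
    using assms s by (auto simp: log_less_one_cancel_iff)
  ultimately have "frac (log B x) = log B s" by (simp add: frac_eq)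
  then show "s = B powr frac (log B x)" using assms s by simp
qed

lemma significand_le_iff:
  assumes "1 < B" "0 < x" "1 \<le> s"
  shows "1 \<le> significand B x \<and> significand B x \<le> s \<longleftrightarrow> frac (log B x) \<le> log B s"
  using assms by (auto simp: significand_eq ge_one_powr_ge_zero le_log_iff)

text \<open>The significand of \<open>x\<close> depends only on the fractional part of \<open>log B x\<close>, so Weyl's
  criterion applies to the base-\<open>B\<close> logarithms.\<close>

lemma strong_benford_criterion:
  assumes B: "1 < B"
    and ne: "\<And>n. A n \<noteq> {#}" and pos: "\<And>n x. x \<in># A n \<Longrightarrow> 0 < x"
    and lim: "\<And>h::int. h \<noteq> 0 \<Longrightarrow>
        (\<lambda>n. (\<Sum>x\<in>#A n. cis (2 * pi * of_int h / ln B * ln x)) / of_nat (size (A n))) \<longlonglongrightarrow> 0"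
  shows "strong_benford B A"
  unfolding strong_benford_def
proof (intro conjI allI ballI pos)
  fix s assume s: "s \<in> {1..<B}"
  let ?A = "\<lambda>n. image_mset (log B) (A n)"
  have "(\<lambda>n. proportion (?A n) (\<lambda>x. frac x \<le> log B s)) \<longlonglongrightarrow> log B s"
  proof (rule weyl_criterion)
    fix h :: int assume "h \<noteq> 0"
    then show "(\<lambda>n. average (?A n) (\<lambda>x. circle x powi h)) \<longlonglongrightarrow> 0"
      using lim[of h] by (simp add: average_def circle_powi log_def multiset.map_comp o_def)
  qed (use ne s B in auto)
  moreover have "size {#x \<in># ?A n. frac x \<le> log B s#}
      = size {#x \<in># A n. 1 \<le> significand B x \<and> significand B x \<le> s#}" for n
    using significand_le_iff[OF B pos] s
    by (auto simp: filter_mset_image_mset cong: filter_mset_cong)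
  ultimately show "(\<lambda>n. real (size {#x \<in># A n. 1 \<le> significand B x \<and> significand B x \<le> s#})
              / real (size (A n))) \<longlonglongrightarrow> log B s"
    by (simp add: proportion_def)
qed

section \<open>Galton-Watson trees\<close>

lemma sum_sticks_Suc:
  "(\<Sum>u\<in>sticks \<kappa> (Suc n). f u) = (\<Sum>v\<in>sticks \<kappa> n. \<Sum>i<\<kappa> v. f (i # v))" (is "?A = ?B")
  and finite_sticks: "finite (sticks \<kappa> n)"
proof -
  have eq: "sticks \<kappa> (Suc n) = (\<lambda>(v, i). i # v) ` Sigma (sticks \<kappa> n) (\<lambda>v. {..<\<kappa> v})" for n
    by auto
  show fin: "finite (sticks \<kappa> n)" for n
  proof (induction n)
    case (Suc n)
    then show ?case unfolding eq by (intro finite_imageI finite_SigmaI) auto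
  qed simp
  have "inj_on (\<lambda>(v, i). i # v) (Sigma (sticks \<kappa> n) (\<lambda>v. {..<\<kappa> v}))"
    by (auto simp: inj_on_def)
  then show "?A = ?B"
    by (simp only: eq sum.reindex) (simp add: sum.Sigma fin case_prod_beta o_def)
qed

text \<open>Addresses over the alphabet \<open>{..<m}\<close>.  They form a finite set that contains all sticks of a
  level of any tree with at most \<open>m\<close> pieces per stick, which allows random trees to be treated as families of random numbers
  with a fixed finite index set.\<close>

definition words :: "nat \<Rightarrow> nat \<Rightarrow> nat list set" where
  "words m n = {v. set v \<subseteq> {..<m} \<and> length v = n}"

definition words_below :: "nat \<Rightarrow> nat \<Rightarrow> nat list set" where
  "words_below m n = (\<Union>k<n. words m k)"

lemma finite_words: "finite (words m n)"
  unfolding words_def using finite_lists_length_eq[of "{..<m}" n] by simp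

lemma finite_words_below: "finite (words_below m n)"
  by (simp add: words_below_def finite_words)

lemma words_below_Suc: "words_below m (Suc n) = words_below m n \<union> words m n"
  by (auto simp: words_below_def less_Suc_eq)

lemma words_disjoint: "words_below m n \<inter> words m n = {}"
  by (auto simp: words_below_def words_def)

lemma words_below_mono: "k \<le> n \<Longrightarrow> words_below m k \<subseteq> words_below m n"
  by (fastforce simp: words_below_def)

lemma words_subset_below: "k < n \<Longrightarrow> words m k \<subseteq> words_below m n"
  by (auto simp: words_below_def)

lemma sticks_subset_words:
  assumes "\<And>v. v \<in> words_below m n \<Longrightarrow> \<kappa> v \<le> m"
  shows "sticks \<kappa> n \<subseteq> words m n"
  using assms
proof (induction n)
  case (Suc n)
  then have "sticks \<kappa> n \<subseteq> words m n" by (simp add: words_below_Suc)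
  then show ?case using Suc.prems by (fastforce simp: words_def words_below_Suc)
qed (simp add: words_def)

lemma sticks_cong:
  assumes "\<And>v. v \<in> words_below m n \<Longrightarrow> \<kappa> v \<le> m" "\<And>v. v \<in> words_below m n \<Longrightarrow> \<kappa>' v = \<kappa> v"
  shows "sticks \<kappa>' n = sticks \<kappa> n"
  using assms
proof (induction n)
  case (Suc n)
  then have eq: "sticks \<kappa>' n = sticks \<kappa> n" by (simp add: words_below_Suc)
  have "sticks \<kappa> n \<subseteq> words m n"
    using Suc.prems by (intro sticks_subset_words) (simp add: words_below_Suc)
  then have "\<kappa>' v = \<kappa> v" if "v \<in> sticks \<kappa> n" for v
    using that Suc.prems(2) by (auto simp: words_below_Suc)
  then show ?case by (auto simp: eq)
qed simp

lemma sticks_nonempty: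
  assumes "\<And>v. v \<in> words_below m n \<Longrightarrow> \<kappa> v \<in> {1..m}"
  shows "sticks \<kappa> n \<noteq> {}"
  using assms
proof (induction n)
  case (Suc n)
  then obtain v where v: "v \<in> sticks \<kappa> n" by (auto simp: words_below_Suc)
  moreover have "sticks \<kappa> n \<subseteq> words m n"
    using Suc.prems by (intro sticks_subset_words) (auto simp: words_below_Suc)
  ultimately have "0 < \<kappa> v" using Suc.prems by (force simp: words_below_Suc)
  then show ?case using v by auto
qed simp

text \<open>The product of \<open>c (\<kappa> u)\<close> over the proper ancestors \<open>u\<close> of the first stick that are not ancestors
  of the second one.  For two addresses of the same length, the recursion stops as soon as the
  parents agree, that is, at the last common ancestor.  One could also damp along the second path, but
  one path already gives geometric decay.\<close>

fun pair_weight :: "(nat \<Rightarrow> real) \<Rightarrow> (nat list \<Rightarrow> nat) \<Rightarrow> nat list \<Rightarrow> nat list \<Rightarrow> real" where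
  "pair_weight c \<kappa> (i # v) (j # w) = (if v = w then 1 else c (\<kappa> v) * pair_weight c \<kappa> v w)"
| "pair_weight c \<kappa> _ _ = 1"

lemma pair_weight_bounds:
  assumes "\<And>k. 0 \<le> c k \<and> c k \<le> 1"
  shows "0 \<le> pair_weight c \<kappa> v w \<and> pair_weight c \<kappa> v w \<le> 1"
  using assms by (induction c \<kappa> v w rule: pair_weight.induct) (auto intro: mult_le_one)

lemma pair_weight_cong:
  assumes "v \<in> words m n" "w \<in> words m n" "\<And>u. u \<in> words_below m n \<Longrightarrow> \<kappa>' u = \<kappa> u"
  shows "pair_weight c \<kappa>' v w = pair_weight c \<kappa> v w"
  using assms
proof (induction c \<kappa> v w arbitrary: n rule: pair_weight.induct)
  case (1 c \<kappa> i v j w)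
  then obtain k where k: "n = Suc k" "v \<in> words m k" "w \<in> words m k"
    by (cases n) (auto simp: words_def)
  then have "pair_weight c \<kappa>' v w = pair_weight c \<kappa> v w" if "v \<noteq> w"
    using 1 that by (auto simp: words_below_Suc)
  moreover have "\<kappa>' v = \<kappa> v" using 1 k by (auto simp: words_below_Suc)
  ultimately show ?case by simp
qed simp_all

definition total_weight :: "(nat \<Rightarrow> real) \<Rightarrow> (nat list \<Rightarrow> nat) \<Rightarrow> nat \<Rightarrow> real" where
  "total_weight c \<kappa> n = (\<Sum>v\<in>sticks \<kappa> n. \<Sum>w\<in>sticks \<kappa> n. pair_weight c \<kappa> v w)"

definition correlation :: "(nat \<Rightarrow> real) \<Rightarrow> (nat list \<Rightarrow> nat) \<Rightarrow> nat \<Rightarrow> real" where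
  "correlation c \<kappa> n = total_weight c \<kappa> n / (real (card (sticks \<kappa> n)))\<^sup>2"

lemma correlation_bounds:
  assumes "\<And>k. 0 \<le> c k \<and> c k \<le> 1"
  shows "0 \<le> correlation c \<kappa> n \<and> correlation c \<kappa> n \<le> 1"
proof -
  have "0 \<le> total_weight c \<kappa> n"
    unfolding total_weight_def using pair_weight_bounds[of c, OF assms] by (intro sum_nonneg) auto
  moreover have "total_weight c \<kappa> n \<le> (\<Sum>v\<in>sticks \<kappa> n. \<Sum>w\<in>sticks \<kappa> n. 1)"
    unfolding total_weight_def using pair_weight_bounds[of c, OF assms] by (intro sum_mono) auto
  ultimately show ?thesis
    by (auto simp: correlation_def power2_eq_square divide_le_eq_1)
qed

lemma card_sticks_Suc: "card (sticks \<kappa> (Suc n)) = (\<Sum>v\<in>sticks \<kappa> n. \<kappa> v)"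
  using sum_sticks_Suc[of "\<lambda>_. 1::nat" \<kappa> n] by simp

text \<open>Pairs of children of one stick weigh \<open>1\<close>; children of distinct sticks inherit the weight of their
  parents, damped once.\<close>

lemma total_weight_Suc:
  "total_weight c \<kappa> (Suc n) = (\<Sum>v\<in>sticks \<kappa> n. (real (\<kappa> v))\<^sup>2)
     + (\<Sum>v\<in>sticks \<kappa> n. \<Sum>w\<in>sticks \<kappa> n - {v}. pair_weight c \<kappa> v w * (\<kappa> v * c (\<kappa> v) * \<kappa> w))"
proof -
  let ?S = "sticks \<kappa> n"
  have "total_weight c \<kappa> (Suc n) = (\<Sum>v\<in>?S. \<Sum>w\<in>?S. \<Sum>i<\<kappa> v. \<Sum>j<\<kappa> w. pair_weight c \<kappa> (i # v) (j # w))"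
    by (simp only: total_weight_def sum_sticks_Suc) (intro sum.cong refl sum.swap)
  also have "\<dots> = (\<Sum>v\<in>?S. \<Sum>w\<in>?S. if w = v then (real (\<kappa> v))\<^sup>2 else pair_weight c \<kappa> v w * (\<kappa> v * c (\<kappa> v) * \<kappa> w))"
    by (intro sum.cong refl) (auto simp: power2_eq_square mult_ac)
  also have "\<dots> = (\<Sum>v\<in>?S. (real (\<kappa> v))\<^sup>2 + (\<Sum>w\<in>?S - {v}. pair_weight c \<kappa> v w * (\<kappa> v * c (\<kappa> v) * \<kappa> w)))"
    by (intro sum.cong refl, subst (1) sum.remove[OF finite_sticks], assumption) (auto intro!: sum.cong)
  finally show ?thesis by (simp add: sum.distrib)
qed

subsection \<open>Exchangeability of the offspring numbers\<close>

lemma expectation_Pi_pmf_permute: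
  assumes L: "finite L" and S: "S \<subseteq> L" and \<pi>: "\<pi> permutes S"
  shows "measure_pmf.expectation (Pi_pmf L d (\<lambda>_. G)) (\<lambda>g. f (g \<circ> \<pi>))
       = measure_pmf.expectation (Pi_pmf L d (\<lambda>_. G)) (f :: _ \<Rightarrow> real)"
proof -
  have \<pi>: "\<pi> permutes L" using \<pi> S by (rule permutes_subset)
  have "Pi_pmf L d (\<lambda>_. G) = map_pmf (\<lambda>g. g \<circ> \<pi>) (Pi_pmf L d (\<lambda>_. G))"
    by (rule Pi_pmf_bij_betw[OF L permutes_imp_bij[OF \<pi>]]) (simp add: permutes_not_in[OF \<pi>])
  then show ?thesis by (metis integral_map_pmf)
qed

text \<open>A permutation of \<open>S\<close> carries \<open>(v, w)\<close> to \<open>(v', w')\<close>, and the total over \<open>S\<close> is symmetric.\<close>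

lemma expectation_Pi_pmf_pair_eq:
  fixes f :: "'b \<Rightarrow> 'b \<Rightarrow> nat \<Rightarrow> real" and h :: "'b \<Rightarrow> nat" and d :: 'b and G :: "'b pmf"
  assumes "finite L" "S \<subseteq> L" and vw: "v \<in> S" "w \<in> S" "v \<noteq> w" "v' \<in> S" "w' \<in> S" "v' \<noteq> w'"
  defines "P \<equiv> Pi_pmf L d (\<lambda>_. G)"
  shows "measure_pmf.expectation P (\<lambda>g. f (g v) (g w) (\<Sum>u\<in>S. h (g u)))
       = measure_pmf.expectation P (\<lambda>g. f (g v') (g w') (\<Sum>u\<in>S. h (g u)))"
proof -
  \<comment> \<open>Move \<open>v\<close> to \<open>v'\<close>, and then the place where \<open>w\<close> has arrived to \<open>w'\<close>.\<close>
  define \<pi> where "\<pi> = Transposition.transpose (Transposition.transpose v v' w) w' \<circ> Transposition.transpose v v'"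
  have \<pi>: "\<pi> permutes S"
    unfolding \<pi>_def using vw
    by (intro permutes_compose permutes_swap_id) (auto simp: Transposition.transpose_def)
  have eq: "\<pi> v = v'" "\<pi> w = w'" using vw by (auto simp: \<pi>_def Transposition.transpose_def)
  have "(\<Sum>u\<in>S. h ((g \<circ> \<pi>) u)) = (\<Sum>u\<in>S. h (g u))" for g
    using sum.permute[OF \<pi>, of "\<lambda>u. h (g u)"] by (simp add: o_def)
  then show ?thesis
    using expectation_Pi_pmf_permute[OF assms(1,2) \<pi>, of d G "\<lambda>g. f (g v) (g w) (\<Sum>u\<in>S. h (g u))"]
    by (simp add: P_def eq)
qed

text \<open>A stick that is left unbroken does not change the phase, hence the value \<open>1\<close> for \<open>k = 1\<close>.\<close>

definition damping :: "real \<Rightarrow> nat \<Rightarrow> real" where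
  "damping \<rho> k = (if k \<le> 1 then 1 else \<rho>)"

definition branching :: "'a set \<Rightarrow> ('a \<Rightarrow> nat) \<Rightarrow> real" where
  "branching S g = (\<Sum>v\<in>S. of_bool (2 \<le> g v))"

lemma branching_bounds: "0 \<le> branching S g" "branching S g \<le> real (card S)"
proof -
  show "0 \<le> branching S g" unfolding branching_def by (intro sum_nonneg) auto
  have "branching S g \<le> (\<Sum>v\<in>S. 1)" unfolding branching_def by (intro sum_mono) auto
  then show "branching S g \<le> real (card S)" by simp
qed

text \<open>With \<open>k\<close> individuals of which \<open>b\<close> have at least two children, there are at least \<open>k + b\<close>
  children, and \<open>1 / (k + b) \<le> (1 - b / (2 k)) / k\<close> because \<open>b \<le> k\<close>.  The right-hand side is
  linear in \<open>b\<close>, so its expectation is immediate.\<close>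

lemma inverse_sum_le_branching:
  fixes g :: "'a \<Rightarrow> nat"
  assumes S: "finite S" "S \<noteq> {}" and g: "\<And>v. v \<in> S \<Longrightarrow> 1 \<le> g v"
  shows "1 / real (\<Sum>v\<in>S. g v) \<le> (1 - branching S g / (2 * real (card S))) / real (card S)"
proof -
  define k where "k = real (card S)"
  define b where "b = branching S g"
  have k: "0 < k" using S by (simp add: k_def card_gt_0_iff)
  have b: "0 \<le> b" "b \<le> k" using branching_bounds by (auto simp: b_def k_def)
  have "(\<Sum>v\<in>S. 1 + of_bool (2 \<le> g v)) \<le> (\<Sum>v\<in>S. real (g v))"
    using g by (intro sum_mono) (force simp: of_bool_def)
  then have "k + b \<le> real (\<Sum>v\<in>S. g v)"
    by (simp add: sum.distrib k_def b_def branching_def)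
  then have "1 / real (\<Sum>v\<in>S. g v) \<le> 1 / (k + b)"
    using k b by (intro divide_left_mono) auto
  also have "\<dots> \<le> (1 - b / (2 * k)) / k"
  proof -
    have "b * b \<le> b * k" using b by (intro mult_left_mono)
    then show ?thesis using k b by (simp add: field_simps)
  qed
  finally show ?thesis by (simp add: k_def b_def)
qed

text \<open>Individuals with at least two children form the fraction \<open>b / k\<close> of the present generation and
  at least that fraction of the next one, since everybody else has exactly one child.\<close>

lemma damped_sum_le_branching:
  fixes g :: "'a \<Rightarrow> nat"
  assumes S: "finite S" "S \<noteq> {}" and g: "\<And>v. v \<in> S \<Longrightarrow> 1 \<le> g v" and \<rho>: "\<rho> \<le> 1"
  shows "(\<Sum>v\<in>S. real (g v) * damping \<rho> (g v)) / real (\<Sum>v\<in>S. g v)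
       \<le> 1 - (1 - \<rho>) * (branching S g / real (card S))"
proof -
  define k where "k = real (card S)"
  define b where "b = branching S g"
  define x where "x = (\<Sum>v\<in>S. real (g v) * of_bool (2 \<le> g v))"
  define T where "T = real (\<Sum>v\<in>S. g v)"
  have k: "0 < k" using S by (simp add: k_def card_gt_0_iff)
  have b: "0 \<le> b" "b \<le> k" using branching_bounds by (auto simp: b_def k_def)
  have x: "b \<le> x" unfolding x_def b_def branching_def
    by (intro sum_mono) (auto simp: of_bool_def)
  have "(\<Sum>v\<in>S. real (g v)) = (\<Sum>v\<in>S. real (g v) * of_bool (2 \<le> g v) + (1 - of_bool (2 \<le> g v)))"
    using g by (intro sum.cong refl) (force simp: of_bool_def)
  then have T: "T = x + (k - b)"
    by (simp add: T_def x_def k_def b_def branching_def sum.distrib sum_subtractf)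
  have T0: "0 < T"
    using T x b k by (cases "b = k") auto
  have "(\<Sum>v\<in>S. real (g v) * damping \<rho> (g v)) = (\<Sum>v\<in>S. real (g v) - (1 - \<rho>) * (real (g v) * of_bool (2 \<le> g v)))"
    by (intro sum.cong refl) (auto simp: damping_def of_bool_def algebra_simps)
  then have "(\<Sum>v\<in>S. real (g v) * damping \<rho> (g v)) = T - (1 - \<rho>) * x"
    by (simp add: T_def x_def sum_subtractf sum_distrib_left)
  then have "(\<Sum>v\<in>S. real (g v) * damping \<rho> (g v)) / T = 1 - (1 - \<rho>) * (x / T)"
    using T0 by (simp add: field_simps)
  moreover have "b / k \<le> x / T"
  proof -
    have "0 \<le> (x - b) * (k - b)" using x b by simp
    then show ?thesis using k T0 by (simp add: T divide_le_eq le_divide_eq field_simps)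
  qed
  ultimately show ?thesis
    using mult_left_mono[of "b / k" "x / T" "1 - \<rho>"] \<rho> by (simp add: T_def k_def b_def)
qed

locale offspring =
  fixes G :: "nat pmf" and m :: nat and \<rho> :: real
  assumes supp: "set_pmf G \<subseteq> {1..m}" and p1: "pmf G 1 < 1"
    and \<rho>: "0 \<le> \<rho>" "\<rho> < 1"
begin

abbreviation "E p f \<equiv> measure_pmf.expectation p (f :: _ \<Rightarrow> real)"

definition p where "p = 1 - pmf G 1"

lemma p: "0 < p" "p \<le> 1" using p1 by (auto simp: p_def pmf_nonneg)

lemma finite_set_G: "finite (set_pmf G)"
  using supp by (rule finite_subset) simp

lemma expectation_ge2: "E G (\<lambda>k. of_bool (2 \<le> k)) = p"
proof -
  have "E G (\<lambda>k. of_bool (2 \<le> k)) = E G (\<lambda>k. 1 - indicator {1} k)"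
    using supp by (intro integral_cong_AE) (auto simp: AE_measure_pmf_iff of_bool_def indicator_def)
  also have "\<dots> = 1 - measure_pmf.prob G {1}"
    by (subst Bochner_Integration.integral_diff)
       (auto intro!: integrable_measure_pmf_finite finite_set_G)
  finally show ?thesis by (simp add: p_def measure_pmf_single)
qed

definition offspring_of :: "nat list set \<Rightarrow> (nat list \<Rightarrow> nat) pmf" where
  "offspring_of L = Pi_pmf L 1 (\<lambda>_. G)"

lemma offspring_of_range:
  assumes "finite L" "g \<in> set_pmf (offspring_of L)" "v \<in> L" shows "g v \<in> {1..m}"
  using assms supp by (auto simp: offspring_of_def set_Pi_pmf PiE_dflt_def)

lemma finite_set_offspring_of: "finite L \<Longrightarrow> finite (set_pmf (offspring_of L))"
  by (auto simp: offspring_of_def set_Pi_pmf intro!: finite_PiE_dflt finite_set_G)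

lemma integrable_offspring_of: "finite L \<Longrightarrow> integrable (offspring_of L) (f :: _ \<Rightarrow> real)"
  by (intro integrable_measure_pmf_finite finite_set_offspring_of)

lemma E_mono:
  assumes "finite L" "\<And>g. g \<in> set_pmf (offspring_of L) \<Longrightarrow> f g \<le> h g"
  shows "E (offspring_of L) f \<le> E (offspring_of L) h"
  using assms by (intro integral_mono_AE integrable_offspring_of) (auto simp: AE_measure_pmf_iff)

lemma expectation_branching:
  assumes "finite L" "S \<subseteq> L" shows "E (offspring_of L) (branching S) = card S * p"
proof -
  have "E (offspring_of L) (\<lambda>g. of_bool (2 \<le> g v)) = p" if "v \<in> S" for v
  proof -
    have "E (offspring_of L) (\<lambda>g. of_bool (2 \<le> g v)) = E (map_pmf (\<lambda>g. g v) (offspring_of L)) (\<lambda>k. of_bool (2 \<le> k))"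
      by simp
    also have "map_pmf (\<lambda>g. g v) (offspring_of L) = G"
      using that assms by (auto simp: offspring_of_def Pi_pmf_component)
    finally show ?thesis by (simp add: expectation_ge2)
  qed
  then show ?thesis
    by (simp add: branching_def[abs_def] Bochner_Integration.integral_sum integrable_offspring_of assms)
qed

definition \<eta> where "\<eta> = 1 - p / 2"
definition \<gamma> where "\<gamma> = 1 - (1 - \<rho>) * p"

lemma \<eta>: "0 \<le> \<eta>" "\<eta> < 1" using p by (auto simp: \<eta>_def)

lemma \<gamma>: "0 \<le> \<gamma>" "\<gamma> < 1"
  using p \<rho> mult_le_one[of "1 - \<rho>" p] by (auto simp: \<gamma>_def)

lemma expectation_inverse_le:
  assumes L: "finite L" "S \<subseteq> L" "S \<noteq> {}"
  shows "E (offspring_of L) (\<lambda>g. 1 / real (\<Sum>v\<in>S. g v)) \<le> \<eta> * (1 / card S)"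
proof -
  have S: "finite S" using L finite_subset by blast
  have "E (offspring_of L) (\<lambda>g. 1 / real (\<Sum>v\<in>S. g v))
      \<le> E (offspring_of L) (\<lambda>g. (1 - branching S g / (2 * real (card S))) / real (card S))"
    using L offspring_of_range[OF L(1)]
    by (intro E_mono inverse_sum_le_branching S L) auto
  also have "\<dots> = \<eta> * (1 / card S)"
    using S L by (simp add: integrable_offspring_of expectation_branching \<eta>_def)
  finally show ?thesis .
qed

text \<open>By exchangeability the expectation is the same for every ordered pair, so it is its sum over all
  pairs divided by their number.  Without the restriction \<open>w \<noteq> v\<close>, the last factor of the
  numerator sums to the total number of children and cancels one power of it; what remains is the
  damped fraction bounded in \<open>damped_sum_le_branching\<close>.\<close>

lemma expectation_pair_le:
  assumes L: "finite L" "S \<subseteq> L" and vw: "v \<in> S" "w \<in> S" "v \<noteq> w"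
  shows "E (offspring_of L) (\<lambda>g. real (g v) * damping \<rho> (g v) * real (g w) / (real (\<Sum>u\<in>S. g u))\<^sup>2)
     \<le> \<gamma> / (real (card S) * real (card S - 1))"
proof -
  have S: "finite S" using L finite_subset by blast
  let ?f = "\<lambda>v w g. real (g v) * damping \<rho> (g v) * real (g w) / (real (\<Sum>u\<in>S. g u))\<^sup>2"
  define \<beta> where "\<beta> = E (offspring_of L) (?f v w)"
  have \<beta>: "E (offspring_of L) (?f v' w') = \<beta>" if "v' \<in> S" "w' \<in> S - {v'}" for v' w'
    unfolding \<beta>_def offspring_of_def using that vw
    by (intro expectation_Pi_pmf_pair_eq[OF L, where f = "\<lambda>a b s. real a * damping \<rho> a * real b / (real s)\<^sup>2" and h = "\<lambda>x. x"]) auto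
  have "real (card S) * real (card S - 1) * \<beta> = (\<Sum>v\<in>S. \<Sum>w\<in>S - {v}. \<beta>)"
    using S by simp
  also have "\<dots> = (\<Sum>v\<in>S. \<Sum>w\<in>S - {v}. E (offspring_of L) (?f v w))"
    by (intro sum.cong refl \<beta>[symmetric])
  also have "\<dots> = E (offspring_of L) (\<lambda>g. \<Sum>v\<in>S. \<Sum>w\<in>S - {v}. ?f v w g)"
    by (simp add: Bochner_Integration.integral_sum integrable_offspring_of L)
  also have "\<dots> \<le> E (offspring_of L) (\<lambda>g. 1 - (1 - \<rho>) * (branching S g / real (card S)))"
  proof (rule E_mono[OF L(1)])
    fix g assume g: "g \<in> set_pmf (offspring_of L)"
    have g1: "1 \<le> g v" if "v \<in> S" for v using offspring_of_range[OF L(1) g] that L by auto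
    have T: "0 < real (\<Sum>u\<in>S. g u)"
      using vw g1[of v] member_le_sum[of v S g] S by (simp del: of_nat_sum)
    have d: "0 \<le> damping \<rho> k" for k using \<rho> by (simp add: damping_def)
    have "(\<Sum>v\<in>S. \<Sum>w\<in>S - {v}. ?f v w g) \<le> (\<Sum>v\<in>S. \<Sum>w\<in>S. ?f v w g)"
      using S d by (intro sum_mono sum_mono2) (auto intro!: divide_nonneg_nonneg mult_nonneg_nonneg)
    also have "\<dots> = (\<Sum>v\<in>S. real (g v) * damping \<rho> (g v)) * (real (\<Sum>u\<in>S. g u)) / (real (\<Sum>u\<in>S. g u))\<^sup>2"
      by (simp add: sum_divide_distrib[symmetric] sum_product)
    also have "\<dots> = (\<Sum>v\<in>S. real (g v) * damping \<rho> (g v)) / real (\<Sum>u\<in>S. g u)"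
      using T by (simp add: power2_eq_square)
    also have "\<dots> \<le> 1 - (1 - \<rho>) * (branching S g / real (card S))"
      using vw g1 \<rho> S by (intro damped_sum_le_branching) auto
    finally show "(\<Sum>v\<in>S. \<Sum>w\<in>S - {v}. ?f v w g) \<le> 1 - (1 - \<rho>) * (branching S g / real (card S))" .
  qed
  also have "\<dots> = \<gamma>"
    using S L vw by (auto simp: integrable_offspring_of expectation_branching \<gamma>_def)
  finally have "real (card S) * real (card S - 1) * \<beta> \<le> \<gamma>" .
  moreover have "2 \<le> card S"
    using vw S card_mono[of S "{v, w}"] by auto
  ultimately show ?thesis by (simp add: \<beta>_def le_divide_eq mult_ac)
qed

end

lemma expectation_pair_pmf_finite:
  fixes f :: "'a \<times> 'b \<Rightarrow> real"
  assumes "finite (set_pmf p)" "finite (set_pmf q)"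
  shows "measure_pmf.expectation (pair_pmf p q) f
       = measure_pmf.expectation p (\<lambda>a. measure_pmf.expectation q (\<lambda>b. f (a, b)))"
proof -
  have "measure_pmf.expectation (pair_pmf p q) f
      = (\<Sum>(a, b)\<in>set_pmf p \<times> set_pmf q. f (a, b) * (pmf p a * pmf q b))"
    using assms
    by (subst integral_measure_pmf_real[of "set_pmf p \<times> set_pmf q"]) (auto simp: pmf_pair intro!: sum.cong)
  also have "\<dots> = (\<Sum>a\<in>set_pmf p. (\<Sum>b\<in>set_pmf q. f (a, b) * pmf q b) * pmf p a)"
    by (simp add: sum.cartesian_product[symmetric] sum_distrib_left mult_ac)
  also have "\<dots> = measure_pmf.expectation p (\<lambda>a. measure_pmf.expectation q (\<lambda>b. f (a, b)))"
    using assms by (simp add: integral_measure_pmf_real[of "set_pmf p" p] integral_measure_pmf_real[of "set_pmf q" q])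
  finally show ?thesis .
qed

text \<open>Choose \<open>r\<close> strictly between the two rates and \<open>1\<close>.  Then \<open>e n \<le> D * r ^ n\<close> is inductive as soon
  as \<open>D (r - \<gamma>) \<ge> C\<close>.\<close>

lemma summable_if_contracting:
  fixes e q :: "nat \<Rightarrow> real"
  assumes e: "\<And>n. 0 \<le> e n" "\<And>n. e (Suc n) \<le> \<gamma> * e n + C * q n"
    and q: "\<And>n. q n \<le> \<eta> ^ n"
    and bounds: "0 \<le> \<gamma>" "\<gamma> < 1" "0 \<le> \<eta>" "\<eta> < 1" "0 \<le> C"
  shows "summable e"
proof -
  define r where "r = (max \<gamma> \<eta> + 1) / 2"
  have r: "\<gamma> < r" "\<eta> < r" "0 < r" "r < 1" using bounds by (auto simp: r_def)
  define D where "D = max (e 0) (C / (r - \<gamma>))"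
  have D: "e 0 \<le> D" "C \<le> D * (r - \<gamma>)"
    using r by (auto simp: D_def pos_divide_le_eq[symmetric])
  have "e n \<le> D * r ^ n" for n
  proof (induction n)
    case (Suc n)
    have "e (Suc n) \<le> \<gamma> * e n + C * q n" by (rule e)
    also have "\<dots> \<le> \<gamma> * (D * r ^ n) + C * r ^ n"
    proof (intro add_mono mult_left_mono Suc bounds)
      show "q n \<le> r ^ n"
        using q[of n] power_mono[of \<eta> r n] r bounds by linarith
    qed
    also have "\<dots> \<le> \<gamma> * (D * r ^ n) + (D * (r - \<gamma>)) * r ^ n"
      using D r by (intro add_left_mono mult_right_mono) auto
    also have "\<dots> = D * r ^ Suc n" by (simp add: algebra_simps)
    finally show ?case .
  qed (use D in simp)
  then have "norm (e n) \<le> D * r ^ n" for n using e(1) by simp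
  moreover have "summable (\<lambda>n. D * r ^ n)" using r by (intro summable_mult summable_geometric) auto
  ultimately show ?thesis by (metis summable_comparison_test)
qed

context offspring
begin

text \<open>The law of the numbers of pieces at all addresses below level \<open>n\<close>.  Addresses that carry no stick
  also receive a number; this keeps the law a product.\<close>

definition tree :: "nat \<Rightarrow> (nat list \<Rightarrow> nat) pmf" where
  "tree n = offspring_of (words_below m n)"

lemma expectation_tree_Suc:
  "E (tree (Suc n)) \<Phi> = E (tree n) (\<lambda>\<kappa>. E (offspring_of (words m n))
      (\<lambda>g. \<Phi> (\<lambda>v. if v \<in> words_below m n then \<kappa> v else g v)))"
proof -
  let ?P = "pair_pmf (offspring_of (words_below m n)) (offspring_of (words m n))"
  have "tree (Suc n) = map_pmf (\<lambda>(\<kappa>, g) v. if v \<in> words_below m n then \<kappa> v else g v) ?P"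
    unfolding tree_def offspring_of_def words_below_Suc
    by (rule Pi_pmf_union[OF finite_words_below finite_words words_disjoint])
  then have "E (tree (Suc n)) \<Phi> = E ?P (\<lambda>(\<kappa>, g). \<Phi> (\<lambda>v. if v \<in> words_below m n then \<kappa> v else g v))"
    by (simp add: case_prod_beta')
  then show ?thesis
    by (simp add: tree_def expectation_pair_pmf_finite finite_set_offspring_of finite_words finite_words_below)
qed

lemma tree_step:
  assumes "\<And>\<kappa>. \<kappa> \<in> set_pmf (tree n) \<Longrightarrow> E (offspring_of (words m n))
      (\<lambda>g. \<Phi> (\<lambda>v. if v \<in> words_below m n then \<kappa> v else g v)) \<le> \<Psi> \<kappa>"
  shows "E (tree (Suc n)) \<Phi> \<le> E (tree n) \<Psi>"
  unfolding expectation_tree_Suc using assms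
  by (auto simp: tree_def intro!: E_mono finite_words_below)

lemma tree_range:
  assumes "\<kappa> \<in> set_pmf (tree n)" "v \<in> words_below m n" shows "\<kappa> v \<in> {1..m}"
  using assms offspring_of_range finite_words_below unfolding tree_def by blast

lemma tree_sticks:
  assumes "\<kappa> \<in> set_pmf (tree n)"
  shows "sticks \<kappa> n \<subseteq> words m n" "sticks \<kappa> n \<noteq> {}"
  using tree_range[OF assms] sticks_subset_words[of m n \<kappa>] sticks_nonempty[of m n \<kappa>]
  by (metis atLeastAtMost_iff)+

lemma extended_tree:
  fixes g :: "nat list \<Rightarrow> nat"
  assumes \<kappa>: "\<kappa> \<in> set_pmf (tree n)"
  defines "\<kappa>' \<equiv> \<lambda>v. if v \<in> words_below m n then \<kappa> v else g v"
  shows "sticks \<kappa>' n = sticks \<kappa> n"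
    and "\<And>v. v \<in> sticks \<kappa> n \<Longrightarrow> \<kappa>' v = g v"
    and "\<And>v w. v \<in> sticks \<kappa> n \<Longrightarrow> w \<in> sticks \<kappa> n \<Longrightarrow> pair_weight c \<kappa>' v w = pair_weight c \<kappa> v w"
    and "card (sticks \<kappa>' (Suc n)) = (\<Sum>v\<in>sticks \<kappa> n. g v)"
proof -
  show 1: "sticks \<kappa>' n = sticks \<kappa> n"
    using tree_range[OF \<kappa>] by (intro sticks_cong[of m]) (auto simp: \<kappa>'_def)
  show 2: "\<kappa>' v = g v" if "v \<in> sticks \<kappa> n" for v
    using that tree_sticks[OF \<kappa>] words_disjoint[of m n] by (auto simp: \<kappa>'_def)
  show "pair_weight c \<kappa>' v w = pair_weight c \<kappa> v w" if "v \<in> sticks \<kappa> n" "w \<in> sticks \<kappa> n" for v w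
    using that tree_sticks[OF \<kappa>] by (intro pair_weight_cong[of _ m n]) (auto simp: \<kappa>'_def)
  show "card (sticks \<kappa>' (Suc n)) = (\<Sum>v\<in>sticks \<kappa> n. g v)"
    by (simp only: card_sticks_Suc 1) (simp add: 2)
qed

lemma damping_bounds: "0 \<le> damping \<rho> k \<and> damping \<rho> k \<le> 1"
  using \<rho> by (simp add: damping_def)

lemma expectation_inverse_card_sticks_le:
  "E (tree n) (\<lambda>\<kappa>. 1 / card (sticks \<kappa> n)) \<le> \<eta> ^ n"
proof (induction n)
  case (Suc n)
  have "E (tree (Suc n)) (\<lambda>\<kappa>. 1 / card (sticks \<kappa> (Suc n))) \<le> E (tree n) (\<lambda>\<kappa>. \<eta> * (1 / card (sticks \<kappa> n)))"
  proof (rule tree_step)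
    fix \<kappa> assume \<kappa>: "\<kappa> \<in> set_pmf (tree n)"
    show "E (offspring_of (words m n)) (\<lambda>g. 1 / card (sticks (\<lambda>v. if v \<in> words_below m n then \<kappa> v else g v) (Suc n)))
        \<le> \<eta> * (1 / card (sticks \<kappa> n))"
      unfolding extended_tree(4)[OF \<kappa>]
      by (rule expectation_inverse_le[OF finite_words tree_sticks[OF \<kappa>]])
  qed
  also have "\<dots> = \<eta> * E (tree n) (\<lambda>\<kappa>. 1 / card (sticks \<kappa> n))"
    by (rule integral_mult_right_zero)
  also have "\<dots> \<le> \<eta> ^ Suc n" using Suc \<eta> by (simp add: mult_left_mono)
  finally show ?case .
qed (simp add: tree_def offspring_of_def words_below_def)

lemma correlation_extended_tree_le:
  assumes \<kappa>: "\<kappa> \<in> set_pmf (tree n)" and g: "g \<in> set_pmf (offspring_of (words m n))"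
  shows "correlation (damping \<rho>) (\<lambda>v. if v \<in> words_below m n then \<kappa> v else g v) (Suc n)
    \<le> m / card (sticks \<kappa> n) + (\<Sum>v\<in>sticks \<kappa> n. \<Sum>w\<in>sticks \<kappa> n - {v}. pair_weight (damping \<rho>) \<kappa> v w *
         (real (g v) * damping \<rho> (g v) * real (g w) / (real (\<Sum>u\<in>sticks \<kappa> n. g u))\<^sup>2))"
proof -
  let ?S = "sticks \<kappa> n" and ?T = "real (\<Sum>u\<in>sticks \<kappa> n. g u)"
  let ?R = "\<Sum>v\<in>?S. \<Sum>w\<in>?S - {v}. pair_weight (damping \<rho>) \<kappa> v w * (real (g v) * damping \<rho> (g v) * real (g w))"
  have gS: "g v \<in> {1..m}" if "v \<in> ?S" for v
    using offspring_of_range[OF finite_words g] tree_sticks[OF \<kappa>] that by blast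
  have k: "0 < card ?S" using tree_sticks[OF \<kappa>] finite_sticks by (simp add: card_gt_0_iff)
  have "(\<Sum>v\<in>?S. 1) \<le> (\<Sum>v\<in>?S. g v)" using gS by (intro sum_mono) auto
  then have T: "card ?S \<le> ?T" by (simp del: of_nat_sum)
  have "(\<Sum>v\<in>?S. (real (g v))\<^sup>2) \<le> (\<Sum>v\<in>?S. m * real (g v))"
    using gS unfolding power2_eq_square by (intro sum_mono mult_right_mono) auto
  also have "\<dots> = m * ?T" by (simp add: sum_distrib_left)
  finally have "(\<Sum>v\<in>?S. (real (g v))\<^sup>2) / ?T\<^sup>2 \<le> (m * ?T) / ?T\<^sup>2"
    by (intro divide_right_mono) auto
  also have "\<dots> = m / ?T" using T k by (simp add: power2_eq_square del: of_nat_sum)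
  also have "\<dots> \<le> m / card ?S" using T k by (intro divide_left_mono) auto
  finally have sq: "(\<Sum>v\<in>?S. (real (g v))\<^sup>2) / ?T\<^sup>2 \<le> m / card ?S" .
  have "correlation (damping \<rho>) (\<lambda>v. if v \<in> words_below m n then \<kappa> v else g v) (Suc n)
      = ((\<Sum>v\<in>?S. (real (g v))\<^sup>2) + ?R) / ?T\<^sup>2"
    unfolding correlation_def total_weight_Suc extended_tree(1,4)[OF \<kappa>]
    by (simp add: extended_tree(2,3)[OF \<kappa>] del: of_nat_sum)
  also have "\<dots> = (\<Sum>v\<in>?S. (real (g v))\<^sup>2) / ?T\<^sup>2 + ?R / ?T\<^sup>2" by (rule add_divide_distrib)
  also have "?R / ?T\<^sup>2 = (\<Sum>v\<in>?S. \<Sum>w\<in>?S - {v}. pair_weight (damping \<rho>) \<kappa> v w * (real (g v) * damping \<rho> (g v) * real (g w) / ?T\<^sup>2))"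
    by (simp add: sum_divide_distrib del: of_nat_sum)
  finally show ?thesis using sq by simp
qed

text \<open>The sum over distinct pairs is contracted by \<open>\<gamma>\<close> times \<open>k / (k - 1)\<close>, where \<open>k\<close> is the number of
  sticks, because the average over distinct pairs replaces the average over all pairs.  As the
  correlation is at most \<open>1\<close>, the excess is at most \<open>1 / (k - 1) \<le> 2 / k\<close>.\<close>

lemma expectation_correlation_extended_tree_le:
  assumes \<kappa>: "\<kappa> \<in> set_pmf (tree n)"
  shows "E (offspring_of (words m n))
      (\<lambda>g. correlation (damping \<rho>) (\<lambda>v. if v \<in> words_below m n then \<kappa> v else g v) (Suc n))
    \<le> \<gamma> * correlation (damping \<rho>) \<kappa> n + (m + 2) * (1 / card (sticks \<kappa> n))"
proof -
  let ?S = "sticks \<kappa> n" and ?k = "real (card (sticks \<kappa> n))" and ?V = "correlation (damping \<rho>) \<kappa> n"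
  let ?a = "pair_weight (damping \<rho>) \<kappa>"
  let ?f = "\<lambda>v w g. real (g v) * damping \<rho> (g v) * real (g w) / (real (\<Sum>u\<in>?S. g u))\<^sup>2"
  let ?O = "\<Sum>v\<in>?S. \<Sum>w\<in>?S - {v}. ?a v w"
  have a: "0 \<le> ?a v w" for v w using pair_weight_bounds[of "damping \<rho>", OF damping_bounds] by blast
  have V: "0 \<le> ?V" "?V \<le> 1" using correlation_bounds[of "damping \<rho>", OF damping_bounds] by auto
  have k: "0 < card ?S" using tree_sticks[OF \<kappa>] finite_sticks by (simp add: card_gt_0_iff)
  have int: "integrable (offspring_of (words m n)) f" for f :: "_ \<Rightarrow> real"
    by (intro integrable_offspring_of finite_words)
  have "E (offspring_of (words m n))
      (\<lambda>g. correlation (damping \<rho>) (\<lambda>v. if v \<in> words_below m n then \<kappa> v else g v) (Suc n))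
    \<le> E (offspring_of (words m n)) (\<lambda>g. m / card ?S + (\<Sum>v\<in>?S. \<Sum>w\<in>?S - {v}. ?a v w * ?f v w g))"
    using correlation_extended_tree_le[OF \<kappa>] by (intro E_mono finite_words)
  also have "\<dots> = m / card ?S + (\<Sum>v\<in>?S. \<Sum>w\<in>?S - {v}. ?a v w * E (offspring_of (words m n)) (?f v w))"
    by (subst Bochner_Integration.integral_add[OF int int])
       (simp only: Bochner_Integration.integral_sum[OF int] integral_mult_right_zero, simp)
  also have "\<dots> \<le> m / card ?S + (\<Sum>v\<in>?S. \<Sum>w\<in>?S - {v}. ?a v w * (\<gamma> / (?k * real (card ?S - 1))))"
    using tree_sticks[OF \<kappa>] a
    by (intro add_left_mono sum_mono mult_left_mono expectation_pair_le finite_words) auto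
  also have "\<dots> = m / card ?S + ?O * (\<gamma> / (?k * real (card ?S - 1)))"
    by (simp only: sum_distrib_right)
  also have "?O * (\<gamma> / (?k * real (card ?S - 1))) \<le> \<gamma> * ?V + 2 / ?k"
  proof (cases "card ?S = 1")
    case True
    then show ?thesis using V \<gamma> by simp
  next
    case False
    then have k2: "2 \<le> ?k" using k by simp
    then have k1: "real (card ?S - 1) = ?k - 1" using k by (simp add: of_nat_diff)
    have "?O \<le> (\<Sum>v\<in>?S. \<Sum>w\<in>?S. ?a v w)"
      using a by (intro sum_mono sum_mono2 finite_sticks) auto
    also have "\<dots> = ?V * ?k\<^sup>2" using k by (simp add: correlation_def total_weight_def)
    finally have "?O * (\<gamma> / (?k * (?k - 1))) \<le> ?V * ?k\<^sup>2 * (\<gamma> / (?k * (?k - 1)))"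
      using k2 \<gamma> by (intro mult_right_mono) auto
    also have "\<dots> = \<gamma> * ?V + (\<gamma> * ?V) * (1 / (?k - 1))"
      using k2 by (simp add: field_simps power2_eq_square)
    also have "(\<gamma> * ?V) * (1 / (?k - 1)) \<le> 1 * (2 / ?k)"
      using k2 V \<gamma> by (intro mult_mono mult_le_one) (auto simp: field_simps)
    finally show ?thesis by (simp only: k1) simp
  qed
  finally show ?thesis by (simp add: add_divide_distrib)
qed

theorem summable_expectation_correlation:
  "summable (\<lambda>n. E (tree n) (\<lambda>\<kappa>. correlation (damping \<rho>) \<kappa> n))"
proof (rule summable_if_contracting)
  show "0 \<le> E (tree n) (\<lambda>\<kappa>. correlation (damping \<rho>) \<kappa> n)" for n
    using correlation_bounds[of "damping \<rho>", OF damping_bounds] by (intro Bochner_Integration.integral_nonneg) auto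
  show "E (tree (Suc n)) (\<lambda>\<kappa>. correlation (damping \<rho>) \<kappa> (Suc n))
      \<le> \<gamma> * E (tree n) (\<lambda>\<kappa>. correlation (damping \<rho>) \<kappa> n) + (m + 2) * E (tree n) (\<lambda>\<kappa>. 1 / card (sticks \<kappa> n))" for n
  proof -
    have "E (tree (Suc n)) (\<lambda>\<kappa>. correlation (damping \<rho>) \<kappa> (Suc n))
        \<le> E (tree n) (\<lambda>\<kappa>. \<gamma> * correlation (damping \<rho>) \<kappa> n + (m + 2) * (1 / card (sticks \<kappa> n)))"
      by (rule tree_step[OF expectation_correlation_extended_tree_le])
    also have "\<dots> = \<gamma> * E (tree n) (\<lambda>\<kappa>. correlation (damping \<rho>) \<kappa> n) + (m + 2) * E (tree n) (\<lambda>\<kappa>. 1 / card (sticks \<kappa> n))"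
      by (subst Bochner_Integration.integral_add)
         (simp_all only: integral_mult_right_zero tree_def integrable_offspring_of finite_words_below)
    finally show ?thesis .
  qed
qed (use \<eta> \<gamma> expectation_inverse_card_sticks_le in auto)

end

section \<open>Oscillation of a single gap\<close>

text \<open>The character \<open>t powr (i \<theta>)\<close> of the multiplicative group of positive reals.\<close>

definition osc :: "real \<Rightarrow> real \<Rightarrow> complex" where
  "osc \<theta> t = cis (\<theta> * ln t)"

lemma norm_osc [simp]: "norm (osc \<theta> t) = 1"
  by (simp add: osc_def)

lemma osc_measurable [measurable]: "osc \<theta> \<in> borel_measurable borel"
  unfolding osc_def cis_conv_exp by measurable

lemma osc_mult: "0 < s \<Longrightarrow> 0 < t \<Longrightarrow> osc \<theta> (s * t) = osc \<theta> s * osc \<theta> t"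
  by (simp add: osc_def ln_mult cis_mult algebra_simps)

text \<open>Two points of the same level differ by a factor \<open>exp (2 \<pi> n / \<theta>)\<close> with an integer \<open>n\<close>.\<close>

lemma countable_osc_level:
  assumes "\<theta> \<noteq> 0" shows "countable {t. 0 < t \<and> osc \<theta> t = c}"
proof (cases "\<exists>s>0. osc \<theta> s = c")
  case True
  then obtain s where s: "0 < s" "osc \<theta> s = c" by blast
  have "{t. 0 < t \<and> osc \<theta> t = c} \<subseteq> range (\<lambda>n::int. exp (ln s + 2 * pi * of_int n / \<theta>))"
  proof safe
    fix t assume t: "0 < t" "c = osc \<theta> t"
    then have "sin (\<theta> * ln t) = sin (\<theta> * ln s) \<and> cos (\<theta> * ln t) = cos (\<theta> * ln s)"
      using s by (simp add: osc_def complex_eq_iff)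
    then obtain n :: int where "\<theta> * ln t = \<theta> * ln s + 2 * pi * of_int n"
      using sin_cos_eq_iff[of "\<theta> * ln t" "\<theta> * ln s"] by auto
    then have "ln t = ln s + 2 * pi * of_int n / \<theta>"
      using assms by (simp add: field_simps)
    then have "t = exp (ln s + 2 * pi * of_int n / \<theta>)" using t by (metis exp_ln)
    then show "t \<in> range (\<lambda>n::int. exp (ln s + 2 * pi * of_int n / \<theta>))" by blast
  qed
  then show ?thesis by (rule countable_subset) simp
next
  case False
  then have "{t. 0 < t \<and> osc \<theta> t = c} = {}" by blast
  then show ?thesis by (simp only: countable_empty)
qed

text \<open>This is the equality case of the triangle inequality: if the mean \<open>c\<close> had modulus \<open>1\<close>, the
  nonnegative function \<open>1 - Re (cnj c * z)\<close> would have integral \<open>0\<close>, forcing \<open>z = c\<close> almost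
  everywhere.\<close>

lemma (in prob_space) norm_expectation_unimodular_less:
  fixes z :: "'a \<Rightarrow> complex"
  assumes z: "z \<in> borel_measurable M" "\<And>x. norm (z x) = 1"
    and nonconst: "\<And>c. \<not> (AE x in M. z x = c)"
  shows "norm (expectation z) < 1"
proof -
  have int: "integrable M z" using z by (intro integrable_const_bound[where B = 1]) auto
  define c where "c = expectation z"
  have le: "norm c \<le> 1"
    using integral_norm_bound[of M z] by (simp add: c_def z prob_space)
  have "norm c \<noteq> 1"
  proof
    assume c: "norm c = 1"
    then have cc: "cnj c * c = 1" using complex_norm_square[of c] by (simp add: mult.commute)
    have le1: "Re (cnj c * z x) \<le> 1" for x
      using complex_Re_le_cmod[of "cnj c * z x"] by (simp add: norm_mult z c)
    have int': "integrable M (\<lambda>x. 1 - Re (cnj c * z x))" using int by simp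
    have "(\<integral>x. cnj c * z x \<partial>M) = 1" by (simp add: cc c_def[symmetric] int)
    then have "(\<integral>x. Re (cnj c * z x) \<partial>M) = 1"
      using integral_Re[of M "\<lambda>x. cnj c * z x"] int by simp
    then have "(\<integral>x. 1 - Re (cnj c * z x) \<partial>M) = 0"
      using int by (subst Bochner_Integration.integral_diff) (simp_all add: prob_space)
    then have "AE x in M. 1 - Re (cnj c * z x) = 0"
      using integral_nonneg_eq_0_iff_AE[OF int'] le1 by simp
    then have "AE x in M. z x = c"
    proof eventually_elim
      case (elim x)
      have "norm (cnj c * z x) = 1" by (simp add: norm_mult z c)
      then have "cnj c * z x = 1"
        using elim by (simp add: cmod_def complex_eq_iff power2_eq_square)
      then show ?case using cc by (metis mult.assoc mult.commute mult_1_right)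
    qed
    then show False using nonconst by blast
  qed
  then show ?thesis using le by (simp add: c_def)
qed

lemma distributed_AE_notin_countable:
  assumes "distributed P lborel g f" "countable N"
  shows "AE y in P. g y \<notin> N"
proof -
  have g: "g \<in> measurable P lborel" and [measurable]: "f \<in> borel_measurable lborel"
    using assms(1) by (auto simp: distributed_def)
  have "N \<in> null_sets lborel" using assms(2) by (rule countable_imp_null_set_lborel)
  then have "AE x in density lborel f. x \<notin> N"
    by (subst AE_density) (auto dest: AE_not_in)
  moreover have [measurable]: "N \<in> sets borel" using \<open>N \<in> null_sets lborel\<close> by (auto simp: null_sets_def)
  ultimately have "AE x in distr P lborel g. x \<notin> N"
    by (simp only: distributed_distr_eq_density[OF assms(1)])
  then show ?thesis by (rule AE_distrD[rotated]) fact
qed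

lemma distributed_AE_support:
  assumes "distributed P lborel g f" "A \<in> sets lborel" "\<And>x. x \<notin> A \<Longrightarrow> f x = 0"
  shows "AE y in P. g y \<in> A"
proof -
  have g: "g \<in> measurable P lborel" and [measurable]: "f \<in> borel_measurable lborel" "A \<in> sets borel"
    using assms(1,2) by (auto simp: distributed_def)
  have "AE x in density lborel f. x \<in> A"
    using assms(3) by (subst AE_density) (auto, metis (mono_tags, lifting) AE_I2 less_irrefl)
  then have "AE x in distr P lborel g. x \<in> A"
    by (simp only: distributed_distr_eq_density[OF assms(1)])
  then show ?thesis by (rule AE_distrD[rotated]) fact
qed

lemma rk_restrict: "rk d (restrict x {..<d}) i = rk d x i"
proof -
  have "map (restrict x {..<d}) [0..<d] = map x [0..<d]" by simp
  then show ?thesis by (simp only: rk_def)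
qed

lemma gap_restrict: "gap d (restrict x {..<d}) i = gap d x i"
  by (simp add: gap_def rk_restrict)

lemma gap_0 [simp]: "gap 0 x 0 = 1"
  by (simp add: gap_def rk_def)

lemma good_distribution_prob_space: "good_distribution d P \<Longrightarrow> prob_space P"
  and good_distribution_sets: "good_distribution d P \<Longrightarrow> sets P = sets (PiM {..<d} (\<lambda>_. borel))"
  by (auto simp: good_distribution_def)

text \<open>The first two parts include the unbroken stick, whose only gap is constantly \<open>1\<close>.  In the third
  part the density enters: a gap avoids each countable set almost surely, in particular every level
  set of \<open>osc \<theta>\<close>.\<close>

lemma good_distribution_gap:
  assumes P: "good_distribution d P" and i: "i \<le> d"
  shows good_distribution_gap_measurable: "(\<lambda>y. gap d y i) \<in> borel_measurable P"
    and good_distribution_gap_pos: "AE y in P. 0 < gap d y i"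
    and good_distribution_osc:
      "0 < d \<Longrightarrow> \<theta> \<noteq> 0 \<Longrightarrow> norm (\<integral>y. osc \<theta> (gap d y i) \<partial>P) < 1"
proof -
  interpret P: prob_space P using P by (rule good_distribution_prob_space)
  have distr: "\<exists>f. distributed P lborel (\<lambda>x. gap d x i) (\<lambda>t. ennreal (indicator {0..1} t * f t))" if "0 < d"
    using P i that by (auto simp: good_distribution_def)
  show meas: "(\<lambda>y. gap d y i) \<in> borel_measurable P"
    using distr i by (cases "d = 0") (auto simp: distributed_def)
  show pos: "AE y in P. 0 < gap d y i"
  proof (cases "d = 0")
    case False
    then obtain f where f: "distributed P lborel (\<lambda>x. gap d x i) (\<lambda>t. ennreal (indicator {0..1} t * f t))"
      using distr by auto
    have "AE y in P. gap d y i \<in> {0..1}"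
      by (rule distributed_AE_support[OF f]) auto
    moreover have "AE y in P. gap d y i \<notin> {0}"
      by (rule distributed_AE_notin_countable[OF f]) auto
    ultimately show ?thesis by eventually_elim auto
  qed (use i in simp)
  assume d: "0 < d" and \<theta>: "\<theta> \<noteq> 0"
  obtain f where f: "distributed P lborel (\<lambda>x. gap d x i) (\<lambda>t. ennreal (indicator {0..1} t * f t))"
    using distr d by auto
  show "norm (\<integral>y. osc \<theta> (gap d y i) \<partial>P) < 1"
  proof (rule P.norm_expectation_unimodular_less)
    show "(\<lambda>y. osc \<theta> (gap d y i)) \<in> borel_measurable P" using meas by measurable
    fix c
    show "\<not> (AE y in P. osc \<theta> (gap d y i) = c)"
    proof
      assume "AE y in P. osc \<theta> (gap d y i) = c"
      moreover have "AE y in P. gap d y i \<notin> {t. 0 < t \<and> osc \<theta> t = c}"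
        by (rule distributed_AE_notin_countable[OF f countable_osc_level[OF \<theta>]])
      ultimately have "AE y in P. False" using pos by eventually_elim auto
      then show False by simp
    qed
  qed simp
qed

lemma uniform_oscillation_bound:
  assumes fin: "\<And>k. k \<in> {1..m} \<Longrightarrow> finite (F k)"
    and good: "\<And>k P. k \<in> {1..m} \<Longrightarrow> P \<in> F k \<Longrightarrow> good_distribution (k - 1) P"
    and \<theta>: "\<theta> \<noteq> 0"
  shows "\<exists>\<rho>. 0 \<le> \<rho> \<and> \<rho> < 1 \<and>
    (\<forall>k\<in>{2..m}. \<forall>P\<in>F k. \<forall>i<k. norm (\<integral>y. osc \<theta> (gap (k - 1) y i) \<partial>P) \<le> \<rho>)"
proof -
  define A where "A = (\<Union>k\<in>{2..m}. \<Union>P\<in>F k. (\<lambda>i. norm (\<integral>y. osc \<theta> (gap (k - 1) y i) \<partial>P)) ` {..<k})"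
  have finA: "finite A" unfolding A_def using fin by (intro finite_UN_I) auto
  have lt: "a < 1" if a: "a \<in> A" for a
  proof -
    obtain k P i where "k \<in> {2..m}" "P \<in> F k" "i < k" "a = norm (\<integral>y. osc \<theta> (gap (k - 1) y i) \<partial>P)"
      using a by (auto simp: A_def)
    then show ?thesis using good[of k P] \<theta> by (auto intro!: good_distribution_osc)
  qed
  show ?thesis
  proof (intro exI[of _ "Max (insert 0 A)"] conjI ballI allI impI)
    show "0 \<le> Max (insert 0 A)" using finA by (intro Max_ge) auto
    show "Max (insert 0 A) < 1" using finA lt by (subst Max_less_iff) auto
    fix k P i assume "k \<in> {2..m}" "P \<in> F k" "i < k"
    then show "norm (\<integral>y. osc \<theta> (gap (k - 1) y i) \<partial>P) \<le> Max (insert 0 A)"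
      using finA by (intro Max_ge) (simp, unfold A_def, blast)
  qed
qed

section \<open>Independence of the cuts given the tree\<close>

lemma (in prob_space) integral_uniform_measure:
  fixes f :: "'a \<Rightarrow> 'b::{banach, second_countable_topology}"
  assumes f: "f \<in> borel_measurable M" and S: "S \<in> events"
  shows "(\<integral>x. indicator S x *\<^sub>R f x \<partial>M) = prob S *\<^sub>R (\<integral>x. f x \<partial>uniform_measure M S)"
proof (cases "prob S = 0")
  case True
  then have "AE x in M. x \<notin> S" using S by (simp add: prob_eq_0)
  then have "AE x in M. indicator S x *\<^sub>R f x = 0" by eventually_elim simp
  then have "(\<integral>x. indicator S x *\<^sub>R f x \<partial>M) = 0" by (rule integral_eq_zero_AE)
  then show ?thesis using True by simp
next
  case False
  have "0 < prob S" using False by (simp add: zero_less_measure_iff)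
  then have "indicator S x / emeasure M S = ennreal (indicator S x / prob S)" for x
    using divide_ennreal[of 1 "prob S"] by (cases "x \<in> S") (auto simp: emeasure_eq_measure)
  then have "uniform_measure M S = density M (\<lambda>x. ennreal (indicator S x / prob S))"
    by (simp add: uniform_measure_def)
  then have "(\<integral>x. f x \<partial>uniform_measure M S) = (\<integral>x. (indicator S x / prob S) *\<^sub>R f x \<partial>M)"
    using f S by (simp add: integral_density)
  also have "\<dots> = (\<integral>x. (1 / prob S) *\<^sub>R (indicator S x *\<^sub>R f x) \<partial>M)" by simp
  also have "\<dots> = (1 / prob S) *\<^sub>R (\<integral>x. indicator S x *\<^sub>R f x \<partial>M)" by (rule integral_scaleR_right)
  finally show ?thesis using False by simp
qed

context stick_breaking
begin

definition history :: "nat list set \<Rightarrow> (nat list \<Rightarrow> nat) \<Rightarrow> (nat list \<Rightarrow> (nat \<Rightarrow> real) measure) \<Rightarrow> 'w set" where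
  "history V \<kappa> \<delta> = {\<omega> \<in> space M. \<forall>v\<in>V. K v \<omega> = \<kappa> v \<and> D v \<omega> = \<delta> v}"

definition cuts :: "(nat list \<Rightarrow> nat) \<Rightarrow> nat list \<Rightarrow> 'w \<Rightarrow> nat \<Rightarrow> real" where
  "cuts \<kappa> v \<omega> = restrict (X v \<omega>) {..<\<kappa> v - 1}"

lemma K_measurable: "K v \<in> measurable M (count_space UNIV)"
  using K_indep by (simp add: indep_vars_def)

lemma history_event: "finite V \<Longrightarrow> history V \<kappa> \<delta> \<in> events"
proof -
  assume "finite V"
  note [measurable] = K_measurable D_measurable
  have "{\<omega> \<in> space M. K v \<omega> = \<kappa> v \<and> D v \<omega> = \<delta> v} \<in> events" for v
    by measurable
  then have "{\<omega> \<in> space M. \<forall>v\<in>V. K v \<omega> = \<kappa> v \<and> D v \<omega> = \<delta> v} \<in> events"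
    using \<open>finite V\<close> by (intro sets.sets_Collect_finite_All)
  then show ?thesis by (simp add: history_def)
qed

lemma cuts_measurable:
  assumes "sets P = sets (PiM {..<\<kappa> v - 1} (\<lambda>_. borel))"
  shows "cuts \<kappa> v \<in> measurable M P"
proof -
  have "(\<lambda>\<omega>. restrict (X v \<omega>) {..<\<kappa> v - 1}) \<in> measurable M (PiM {..<\<kappa> v - 1} (\<lambda>_. borel))"
    by (rule measurable_compose[OF X_measurable measurable_restrict_subset]) simp
  then show ?thesis
    using assms by (simp add: cuts_def[abs_def] cong: measurable_cong_sets)
qed

text \<open>Under the measure conditioned on a history of positive probability, the cut vectors are
  independent with the selected laws: the product formula with all but one event trivial gives the
  marginals, and then the formula itself is independence.\<close>

lemma expectation_history_prod:
  fixes f :: "nat list \<Rightarrow> (nat \<Rightarrow> real) \<Rightarrow> complex"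
  assumes V: "finite V"
    and \<delta>: "\<And>v. v \<in> V \<Longrightarrow> \<delta> v \<in> F (\<kappa> v)" "\<And>v. v \<in> V \<Longrightarrow> good_distribution (\<kappa> v - 1) (\<delta> v)"
    and f: "\<And>v. v \<in> V \<Longrightarrow> f v \<in> borel_measurable (\<delta> v)" "\<And>v y. v \<in> V \<Longrightarrow> norm (f v y) \<le> 1"
  shows "(\<integral>\<omega>. indicator (history V \<kappa> \<delta>) \<omega> *\<^sub>R (\<Prod>v\<in>V. f v (cuts \<kappa> v \<omega>)) \<partial>M)
       = prob (history V \<kappa> \<delta>) *\<^sub>R (\<Prod>v\<in>V. \<integral>y. f v y \<partial>\<delta> v)"
proof -
  let ?H = "history V \<kappa> \<delta>"
  have H: "?H \<in> events" using V by (rule history_event)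
  have cuts[measurable]: "cuts \<kappa> v \<in> measurable M (\<delta> v)" if "v \<in> V" for v
    using cuts_measurable good_distribution_sets[OF \<delta>(2)[OF that]] by blast
  have fc: "(\<lambda>\<omega>. f v (cuts \<kappa> v \<omega>)) \<in> borel_measurable M" if "v \<in> V" for v
    using measurable_compose[OF cuts f(1)] that by blast
  then have prodm: "(\<lambda>\<omega>. \<Prod>v\<in>V. f v (cuts \<kappa> v \<omega>)) \<in> borel_measurable M"
    by (intro borel_measurable_prod)
  show ?thesis
  proof (cases "prob ?H = 0 \<or> V = {}")
    case True
    moreover have "(\<integral>\<omega>. indicator ?H \<omega> *\<^sub>R (1::complex) \<partial>M) = prob ?H *\<^sub>R 1"
      using H by (subst integral_scaleR_left) (auto simp: integrable_indicator_iff emeasure_eq_measure)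
    ultimately show ?thesis
      using integral_uniform_measure[OF prodm H] by auto
  next
    case False
    then have V0: "V \<noteq> {}" and H0: "prob ?H \<noteq> 0" by auto
    let ?N = "uniform_measure M ?H"
    have H0': "emeasure M ?H \<noteq> 0" "emeasure M ?H \<noteq> \<infinity>" using H0 by (auto simp: emeasure_eq_measure)
    interpret N: prob_space ?N using H0' by (rule prob_space_uniform_measure)
    have cond: "N.prob (\<Inter>v\<in>V. cuts \<kappa> v -` A v \<inter> space ?N) = (\<Prod>v\<in>V. measure (\<delta> v) (A v))"
      if A: "\<And>v. v \<in> V \<Longrightarrow> A v \<in> sets (\<delta> v)" for A
    proof -
      have ev: "(\<Inter>v\<in>V. cuts \<kappa> v -` A v \<inter> space M) \<in> events"
        using V V0 by (intro sets.finite_INT measurable_sets[OF cuts A])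
      have "?H \<inter> (\<Inter>v\<in>V. cuts \<kappa> v -` A v \<inter> space M)
          = {\<omega> \<in> space M. \<forall>v\<in>V. K v \<omega> = \<kappa> v \<and> D v \<omega> = \<delta> v \<and> restrict (X v \<omega>) {..<\<kappa> v - 1} \<in> A v}"
        by (auto simp: history_def cuts_def)
      then have "prob (?H \<inter> (\<Inter>v\<in>V. cuts \<kappa> v -` A v \<inter> space M)) = prob ?H * (\<Prod>v\<in>V. measure (\<delta> v) (A v))"
        using X_conditional[OF V, of \<delta> \<kappa> A] \<delta> A by (simp add: history_def)
      then show ?thesis
        using H0 measure_uniform_measure[OF H0' ev] by simp
    qed
    have marg: "N.prob (cuts \<kappa> v -` A \<inter> space ?N) = measure (\<delta> v) A" if v: "v \<in> V" and A: "A \<in> sets (\<delta> v)" for v A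
    proof -
      let ?A = "\<lambda>u. if u = v then A else space (\<delta> u)"
      have "(\<Inter>u\<in>V. cuts \<kappa> u -` ?A u \<inter> space ?N) = cuts \<kappa> v -` A \<inter> space ?N"
        using v measurable_space[OF cuts] by (auto split: if_splits)
      then have "N.prob (cuts \<kappa> v -` A \<inter> space ?N) = (\<Prod>u\<in>V. measure (\<delta> u) (?A u))"
        using cond[of ?A] A by auto
      also have "\<dots> = (\<Prod>u\<in>V. if u = v then measure (\<delta> v) A else 1)"
        by (intro prod.cong refl) (auto simp: prob_space.prob_space[OF good_distribution_prob_space[OF \<delta>(2)]])
      also have "\<dots> = measure (\<delta> v) A" using V v by simp
      finally show ?thesis .
    qed
    have cN: "cuts \<kappa> v \<in> measurable ?N (\<delta> v)" if "v \<in> V" for v using cuts[OF that] by simp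
    have "N.indep_vars \<delta> (cuts \<kappa>) V"
    proof (rule N.indep_vars_finite[where E = "\<lambda>v. sets (\<delta> v)", THEN iffD2, OF V0 V])
      show "\<forall>A\<in>Pi V (\<lambda>v. sets (\<delta> v)). N.prob (\<Inter>v\<in>V. cuts \<kappa> v -` A v \<inter> space ?N)
          = (\<Prod>v\<in>V. N.prob (cuts \<kappa> v -` A v \<inter> space ?N))"
      proof
        fix A assume "A \<in> Pi V (\<lambda>v. sets (\<delta> v))"
        then have A: "A v \<in> sets (\<delta> v)" if "v \<in> V" for v using that by auto
        show "N.prob (\<Inter>v\<in>V. cuts \<kappa> v -` A v \<inter> space ?N) = (\<Prod>v\<in>V. N.prob (cuts \<kappa> v -` A v \<inter> space ?N))"
          by (simp only: cond[OF A] marg A cong: prod.cong)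
      qed
    qed (simp_all add: sets.sigma_sets_eq cN sets.Int_stable sets.space_closed del: space_uniform_measure)
    then have "N.indep_vars (\<lambda>_. borel) (\<lambda>v. f v \<circ> cuts \<kappa> v) V"
      using f(1) by (rule N.indep_vars_compose)
    then have ind: "N.indep_vars (\<lambda>_. borel) (\<lambda>v \<omega>. f v (cuts \<kappa> v \<omega>)) V"
      by (simp add: o_def)
    have "integrable ?N (\<lambda>\<omega>. f v (cuts \<kappa> v \<omega>))" if "v \<in> V" for v
      using fc f(2) that by (intro N.integrable_const_bound[where B = 1]) auto
    then have "(\<integral>\<omega>. (\<Prod>v\<in>V. f v (cuts \<kappa> v \<omega>)) \<partial>?N) = (\<Prod>v\<in>V. \<integral>\<omega>. f v (cuts \<kappa> v \<omega>) \<partial>?N)"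
      by (rule N.indep_vars_lebesgue_integral[OF V ind])
    also have "\<dots> = (\<Prod>v\<in>V. \<integral>y. f v y \<partial>\<delta> v)"
    proof (rule prod.cong[OF refl])
      fix v assume v: "v \<in> V"
      interpret P: prob_space "\<delta> v" using \<delta>(2)[OF v] by (rule good_distribution_prob_space)
      have "distr ?N (\<delta> v) (cuts \<kappa> v) = \<delta> v"
      proof (rule measure_eqI)
        fix A assume "A \<in> sets (distr ?N (\<delta> v) (cuts \<kappa> v))"
        then show "emeasure (distr ?N (\<delta> v) (cuts \<kappa> v)) A = emeasure (\<delta> v) A"
          using marg[OF v, of A] cN[OF v]
          by (simp add: emeasure_distr N.emeasure_eq_measure P.emeasure_eq_measure del: space_uniform_measure)
      qed simp
      then show "(\<integral>\<omega>. f v (cuts \<kappa> v \<omega>) \<partial>?N) = (\<integral>y. f v y \<partial>\<delta> v)"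
        using integral_distr[OF cN[OF v] f(1)[OF v]] by simp
    qed
    finally show ?thesis using integral_uniform_measure[OF prodm H] by simp
  qed
qed

end

section \<open>The second moment\<close>

text \<open>The phase \<open>osc \<theta>\<close> of the length of a stick relative to the original one, as a product along the
  path, provided that the gaps on the path are positive.  Unlike the length, it
  has modulus \<open>1\<close> for every input, including nonpositive gaps.\<close>

primrec phase :: "real \<Rightarrow> (nat list \<Rightarrow> nat) \<Rightarrow> (nat list \<Rightarrow> nat \<Rightarrow> real) \<Rightarrow> nat list \<Rightarrow> complex" where
  "phase \<theta> \<kappa> x [] = 1"
| "phase \<theta> \<kappa> x (i # v) = phase \<theta> \<kappa> x v * osc \<theta> (gap (\<kappa> v - 1) (x v) i)"

text \<open>The contribution of the vertex \<open>u\<close> to the phase of a stick, as a function of the cut vector \<open>y\<close>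
  at \<open>u\<close> alone; it is \<open>1\<close> when \<open>u\<close> is not a proper ancestor.  This exhibits the phase as a product over
  the fixed index set \<open>words_below m n\<close>, as needed for independence.\<close>

primrec phase_factor :: "real \<Rightarrow> nat list \<Rightarrow> nat list \<Rightarrow> nat \<Rightarrow> (nat \<Rightarrow> real) \<Rightarrow> complex" where
  "phase_factor \<theta> [] u k y = 1"
| "phase_factor \<theta> (i # v) u k y = (if u = v then osc \<theta> (gap (k - 1) y i) else phase_factor \<theta> v u k y)"

lemma norm_phase_factor [simp]: "norm (phase_factor \<theta> v u k y) = 1"
  by (induction v) auto

lemma phase_factor_eq_1: "length v \<le> length u \<Longrightarrow> phase_factor \<theta> v u k y = 1"
  by (induction v) auto

lemma prod_override:
  assumes "finite V" "v \<in> V" "f v = 1"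
  shows "(\<Prod>u\<in>V. if u = v then a else f u) = a * (\<Prod>u\<in>V. f u)"
proof -
  have "(\<Prod>u\<in>V - {v}. if u = v then a else f u) = (\<Prod>u\<in>V - {v}. f u)"
    by (intro prod.cong) auto
  then show ?thesis using assms by (simp add: prod.remove[of V v])
qed

lemma phase_eq_prod:
  assumes "v \<in> words m k" "k \<le> n"
  shows "phase \<theta> \<kappa> x v = (\<Prod>u\<in>words_below m n. phase_factor \<theta> v u (\<kappa> u) (x u))"
  using assms
proof (induction v arbitrary: k)
  case (Cons i v)
  then obtain j where j: "k = Suc j" "v \<in> words m j" "j < n"
    by (cases k) (auto simp: words_def)
  then have "v \<in> words_below m n" using words_subset_below by blast
  then have "(\<Prod>u\<in>words_below m n. if u = v then osc \<theta> (gap (\<kappa> v - 1) (x v) i) else phase_factor \<theta> v u (\<kappa> u) (x u))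
      = osc \<theta> (gap (\<kappa> v - 1) (x v) i) * (\<Prod>u\<in>words_below m n. phase_factor \<theta> v u (\<kappa> u) (x u))"
    by (intro prod_override finite_words_below) (simp_all add: phase_factor_eq_1)
  moreover have "(\<Prod>u\<in>words_below m n. phase_factor \<theta> (i # v) u (\<kappa> u) (x u))
      = (\<Prod>u\<in>words_below m n. if u = v then osc \<theta> (gap (\<kappa> v - 1) (x v) i) else phase_factor \<theta> v u (\<kappa> u) (x u))"
    by (intro prod.cong) auto
  ultimately show ?case using Cons.IH[of j] j by (simp add: mult.commute)
qed simp

lemma phase_cong:
  assumes "v \<in> words m n" "\<And>u. u \<in> words_below m n \<Longrightarrow> \<kappa>' u = \<kappa> u \<and> restrict (x' u) {..<\<kappa> u - 1} = restrict (x u) {..<\<kappa> u - 1}"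
  shows "phase \<theta> \<kappa>' x' v = phase \<theta> \<kappa> x v"
  using assms
proof (induction v arbitrary: n)
  case (Cons i v)
  then obtain k where k: "n = Suc k" "v \<in> words m k" by (cases n) (auto simp: words_def)
  have "\<kappa>' v = \<kappa> v" "gap (\<kappa> v - 1) (x' v) i = gap (\<kappa> v - 1) (x v) i"
    using Cons.prems(2)[of v] k gap_restrict by (metis UnCI words_below_Suc)+
  then show ?case using Cons k by (simp add: words_below_Suc)
qed simp

locale stick_bounds = stick_breaking M G F K D X + offspring G m \<rho>
  for M :: "'w measure" and G F K D X m \<rho> +
  fixes \<theta> :: real
  assumes F_finite: "\<And>k. k \<in> {1..m} \<Longrightarrow> finite (F k)"
    and F_good: "\<And>k P. k \<in> {1..m} \<Longrightarrow> P \<in> F k \<Longrightarrow> good_distribution (k - 1) P"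
    and osc_le: "\<And>k P i. k \<in> {2..m} \<Longrightarrow> P \<in> F k \<Longrightarrow> i < k \<Longrightarrow>
          norm (\<integral>y. osc \<theta> (gap (k - 1) y i) \<partial>P) \<le> \<rho>"
begin

lemma osc_le_damping:
  assumes "k \<in> {1..m}" "P \<in> F k" "i < k"
  shows "norm (\<integral>y. osc \<theta> (gap (k - 1) y i) \<partial>P) \<le> damping \<rho> k"
proof (cases "k = 1")
  case True
  interpret P: prob_space P using F_good[OF assms(1,2)] by (rule good_distribution_prob_space)
  show ?thesis using True assms integral_norm_bound[of P "\<lambda>y. osc \<theta> (gap (k - 1) y i)"]
    by (simp add: damping_def P.prob_space)
next
  case False
  then show ?thesis using assms osc_le[of k P i] by (simp add: damping_def)
qed

text \<open>For a vertex \<open>u\<close> on the path of \<open>v\<close> only, the second factor is \<open>1\<close>, and the integral is the mean of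
  the oscillation of a single gap.  All other vertices contribute at most \<open>1\<close>.\<close>

lemma prod_phase_factors_le_pair_weight:
  assumes \<kappa>: "\<And>u. u \<in> words_below m n \<Longrightarrow> \<kappa> u \<in> {1..m} \<and> \<delta> u \<in> F (\<kappa> u)"
    and vw: "v \<in> sticks \<kappa> k" "w \<in> sticks \<kappa> k" and k: "k \<le> n"
  shows "(\<Prod>u\<in>words_below m n. norm (\<integral>y. phase_factor \<theta> v u (\<kappa> u) y * cnj (phase_factor \<theta> w u (\<kappa> u) y) \<partial>\<delta> u))
      \<le> pair_weight (damping \<rho>) \<kappa> v w" (is "(\<Prod>u\<in>?V. ?I v w u) \<le> _")
proof -
  have I_le: "?I v w u \<le> 1" if "u \<in> ?V" for v w u
  proof -
    interpret P: prob_space "\<delta> u" using F_good \<kappa>[OF that] good_distribution_prob_space by blast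
    show ?thesis
      using integral_norm_bound[of "\<delta> u" "\<lambda>y. phase_factor \<theta> v u (\<kappa> u) y * cnj (phase_factor \<theta> w u (\<kappa> u) y)"]
      by (simp add: norm_mult P.prob_space)
  qed
  have prod_le: "(\<Prod>u\<in>?V. ?I v w u) \<le> 1" for v w
    using I_le by (intro prod_le_1) auto
  show ?thesis using vw k
  proof (induction k arbitrary: v w)
    case (Suc k)
    then obtain i v' j w' where v: "v = i # v'" "v' \<in> sticks \<kappa> k" "i < \<kappa> v'"
      and w: "w = j # w'" "w' \<in> sticks \<kappa> k" "j < \<kappa> w'" by auto
    have sub: "sticks \<kappa> k \<subseteq> words m k"
      using \<kappa> Suc.prems words_below_mono[of k n m] by (intro sticks_subset_words) auto
    have V: "v' \<in> ?V" "w' \<in> ?V" and len: "length v' = length w'"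
      using v w sub Suc.prems words_subset_below[of k n m] by (auto simp: words_def)
    show ?case
    proof (cases "v' = w'")
      case False
      interpret P: prob_space "\<delta> v'" using F_good \<kappa>[OF V(1)] good_distribution_prob_space by blast
      have eq: "?I v w u = ?I v' w' u" if "u \<noteq> v'" "u \<noteq> w'" for u
        using that by (simp add: v w)
      \<comment> \<open>No stick of level \<open>k\<close> is a proper ancestor of another one, so \<open>v'\<close> and \<open>w'\<close> do not occur
          in the product for the parents; the vertex \<open>v'\<close> then brings in exactly the new damping.\<close>
      have I1: "?I v' w' v' = 1"
        using len by (simp add: phase_factor_eq_1 P.prob_space)
      have v1: "?I v w v' \<le> damping \<rho> (\<kappa> v')"
      proof -
        have "phase_factor \<theta> w v' (\<kappa> v') y = 1" for y
          using len False by (simp add: w phase_factor_eq_1)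
        then show ?thesis using osc_le_damping[of "\<kappa> v'" "\<delta> v'" i] \<kappa>[OF V(1)] v by simp
      qed
      have "(\<Prod>u\<in>?V. ?I v w u) \<le> (\<Prod>u\<in>?V. if u = v' then damping \<rho> (\<kappa> v') else ?I v' w' u)"
      proof (intro prod_mono conjI)
        fix u assume u: "u \<in> ?V"
        have "?I v' w' w' = 1"
        proof -
          interpret Q: prob_space "\<delta> w'" using F_good \<kappa>[OF V(2)] good_distribution_prob_space by blast
          show ?thesis using len by (simp add: phase_factor_eq_1 Q.prob_space)
        qed
        then show "?I v w u \<le> (if u = v' then damping \<rho> (\<kappa> v') else ?I v' w' u)"
          using v1 I_le[OF u, of v w] eq[of u] by (cases "u = v'"; cases "u = w'") auto
      qed simp
      also have "\<dots> = damping \<rho> (\<kappa> v') * (\<Prod>u\<in>?V. ?I v' w' u)"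
        by (rule prod_override[where f = "?I v' w'", OF finite_words_below V(1) I1])
      also have "\<dots> \<le> damping \<rho> (\<kappa> v') * pair_weight (damping \<rho>) \<kappa> v' w'"
        using Suc.IH[OF v(2) w(2)] Suc.prems damping_bounds by (intro mult_left_mono) auto
      finally show ?thesis using False by (simp add: v w)
    qed (use prod_le[of v w] in \<open>simp add: v w\<close>)
  qed (use prod_le[of "[]" "[]"] in simp)
qed

lemma phase_factor_measurable:
  assumes "v \<in> sticks \<kappa> k" "good_distribution (\<kappa> u - 1) P"
  shows "phase_factor \<theta> v u (\<kappa> u) \<in> borel_measurable P"
  using assms(1)
proof (induction k arbitrary: v)
  case (Suc k)
  then obtain i v' where v: "v = i # v'" "v' \<in> sticks \<kappa> k" "i < \<kappa> v'" by auto
  show ?case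
  proof (cases "u = v'")
    case True
    then have "(\<lambda>y. gap (\<kappa> u - 1) y i) \<in> borel_measurable P"
      using v by (intro good_distribution_gap_measurable[OF assms(2)]) simp
    then show ?thesis using True v by (simp add: measurable_compose[OF _ osc_measurable])
  next
    case False
    then show ?thesis using Suc.IH[OF v(2)] by (simp add: v(1))
  qed
qed (simp add: measurable_cong[of P "phase_factor \<theta> [] u (\<kappa> u)" "\<lambda>_. 1"])

definition phase_sum :: "nat \<Rightarrow> (nat list \<Rightarrow> nat) \<Rightarrow> (nat list \<Rightarrow> nat \<Rightarrow> real) \<Rightarrow> complex" where
  "phase_sum n \<kappa> x = (\<Sum>v\<in>sticks \<kappa> n. phase \<theta> \<kappa> x v)"

text \<open>Expand the square of the sum into a sum over pairs, and apply independence to each pair.\<close>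

lemma second_moment_history:
  assumes \<kappa>: "\<And>u. u \<in> words_below m n \<Longrightarrow> \<kappa> u \<in> {1..m} \<and> \<delta> u \<in> F (\<kappa> u)"
  defines "H \<equiv> history (words_below m n) \<kappa> \<delta>" and "S \<equiv> \<lambda>\<omega>. phase_sum n \<kappa> (\<lambda>u. cuts \<kappa> u \<omega>)"
  shows "integrable M (\<lambda>\<omega>. indicator H \<omega> * (norm (S \<omega>))\<^sup>2)"
    and "(\<integral>\<omega>. indicator H \<omega> * (norm (S \<omega>))\<^sup>2 \<partial>M) \<le> prob H * total_weight (damping \<rho>) \<kappa> n"
proof -
  let ?V = "words_below m n"
  let ?f = "\<lambda>v w u y. phase_factor \<theta> v u (\<kappa> u) y * cnj (phase_factor \<theta> w u (\<kappa> u) y)"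
  let ?h = "\<lambda>v w \<omega>. indicator H \<omega> *\<^sub>R (\<Prod>u\<in>?V. ?f v w u (cuts \<kappa> u \<omega>))"
  have good: "good_distribution (\<kappa> u - 1) (\<delta> u)" if "u \<in> ?V" for u
    using \<kappa>[OF that] F_good by blast
  have sub: "sticks \<kappa> n \<subseteq> words m n" using \<kappa> by (intro sticks_subset_words) auto
  have cnj: "cnj \<in> borel_measurable borel"
    by (intro borel_measurable_continuous_onI continuous_intros)
  have fm: "?f v w u \<in> borel_measurable (\<delta> u)" if "v \<in> sticks \<kappa> n" "w \<in> sticks \<kappa> n" "u \<in> ?V" for v w u
    using phase_factor_measurable[OF that(1) good[OF that(3)]]
      measurable_compose[OF phase_factor_measurable[OF that(2) good[OF that(3)]] cnj]
    by (rule borel_measurable_times)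
  have H: "H \<in> events" unfolding H_def by (intro history_event finite_words_below)
  have "(\<lambda>\<omega>. ?f v w u (cuts \<kappa> u \<omega>)) \<in> borel_measurable M" if "v \<in> sticks \<kappa> n" "w \<in> sticks \<kappa> n" "u \<in> ?V" for v w u
    using good_distribution_sets[OF good[OF that(3)]]
    by (intro measurable_compose[OF _ fm[OF that]] cuts_measurable)
  then have int: "integrable M (?h v w)" if "v \<in> sticks \<kappa> n" "w \<in> sticks \<kappa> n" for v w
    using H that
    by (intro integrable_const_bound[where B = 1])
       (auto simp: prod_norm[symmetric] norm_mult indicator_def intro!: borel_measurable_scaleR borel_measurable_prod)
  have expand: "complex_of_real (indicator H \<omega> * (norm (S \<omega>))\<^sup>2) = (\<Sum>v\<in>sticks \<kappa> n. \<Sum>w\<in>sticks \<kappa> n. ?h v w \<omega>)" for \<omega>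
  proof -
    have "phase \<theta> \<kappa> (\<lambda>u. cuts \<kappa> u \<omega>) v * cnj (phase \<theta> \<kappa> (\<lambda>u. cuts \<kappa> u \<omega>) w)
        = (\<Prod>u\<in>?V. ?f v w u (cuts \<kappa> u \<omega>))" if "v \<in> sticks \<kappa> n" "w \<in> sticks \<kappa> n" for v w
      using that sub by (subst (1 2) phase_eq_prod[of _ m n n]) (auto simp: prod.distrib)
    then have "complex_of_real ((norm (S \<omega>))\<^sup>2)
        = (\<Sum>v\<in>sticks \<kappa> n. \<Sum>w\<in>sticks \<kappa> n. \<Prod>u\<in>?V. ?f v w u (cuts \<kappa> u \<omega>))"
      unfolding complex_norm_square S_def phase_sum_def cnj_sum sum_product by (intro sum.cong refl) simp
    then show ?thesis by (simp add: scaleR_conv_of_real sum_distrib_left)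
  qed
  have intc: "integrable M (\<lambda>\<omega>. complex_of_real (indicator H \<omega> * (norm (S \<omega>))\<^sup>2))"
    unfolding expand using int by (intro Bochner_Integration.integrable_sum)
  then show "integrable M (\<lambda>\<omega>. indicator H \<omega> * (norm (S \<omega>))\<^sup>2)"
    using complex_of_real_integrable_eq by blast
  have "(\<integral>\<omega>. indicator H \<omega> * (norm (S \<omega>))\<^sup>2 \<partial>M)
      \<le> norm (complex_of_real (\<integral>\<omega>. indicator H \<omega> * (norm (S \<omega>))\<^sup>2 \<partial>M))"
    by simp
  also have "complex_of_real (\<integral>\<omega>. indicator H \<omega> * (norm (S \<omega>))\<^sup>2 \<partial>M)
      = (\<integral>\<omega>. complex_of_real (indicator H \<omega> * (norm (S \<omega>))\<^sup>2) \<partial>M)"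
    by (rule integral_complex_of_real[symmetric])
  also have "\<dots> = (\<Sum>v\<in>sticks \<kappa> n. \<Sum>w\<in>sticks \<kappa> n. \<integral>\<omega>. ?h v w \<omega> \<partial>M)"
    unfolding expand using int by (simp add: Bochner_Integration.integral_sum Bochner_Integration.integrable_sum)
  also have "\<dots> = (\<Sum>v\<in>sticks \<kappa> n. \<Sum>w\<in>sticks \<kappa> n. prob H *\<^sub>R (\<Prod>u\<in>?V. \<integral>y. ?f v w u y \<partial>\<delta> u))"
    unfolding H_def using \<kappa> good fm
    by (intro sum.cong refl expectation_history_prod finite_words_below) (auto simp: norm_mult)
  also have "norm \<dots> \<le> (\<Sum>v\<in>sticks \<kappa> n. \<Sum>w\<in>sticks \<kappa> n. prob H * pair_weight (damping \<rho>) \<kappa> v w)"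
  proof (intro sum_norm_le)
    fix v w assume vw: "v \<in> sticks \<kappa> n" "w \<in> sticks \<kappa> n"
    have "norm (\<Prod>u\<in>?V. \<integral>y. ?f v w u y \<partial>\<delta> u) \<le> pair_weight (damping \<rho>) \<kappa> v w"
      using prod_phase_factors_le_pair_weight[where \<delta> = \<delta>, OF \<kappa> vw order_refl] by (simp add: prod_norm)
    then show "norm (prob H *\<^sub>R (\<Prod>u\<in>?V. \<integral>y. ?f v w u y \<partial>\<delta> u)) \<le> prob H * pair_weight (damping \<rho>) \<kappa> v w"
      by (simp add: mult_left_mono)
  qed
  also have "\<dots> = prob H * total_weight (damping \<rho>) \<kappa> n"
    by (simp add: total_weight_def sum_distrib_left)
  finally show "(\<integral>\<omega>. indicator H \<omega> * (norm (S \<omega>))\<^sup>2 \<partial>M) \<le> prob H * total_weight (damping \<rho>) \<kappa> n" .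
qed

text \<open>The values that the numbers of pieces can take below level \<open>n\<close>, and, in \<open>selections\<close> below, those
  of the selected distributions.  Off the index set the numbers of pieces are set to \<open>1\<close>, the default value
  of the law \<open>tree n\<close>, so that this set contains the support of that law and is finite.\<close>

definition offspring_functions :: "nat \<Rightarrow> (nat list \<Rightarrow> nat) set" where
  "offspring_functions n = PiE_dflt (words_below m n) 1 (\<lambda>_. {1..m})"

lemma finite_offspring_functions: "finite (offspring_functions n)"
  unfolding offspring_functions_def by (intro finite_PiE_dflt finite_words_below) simp

lemma expectation_tree_eq_sum:
  "E (tree n) f = (\<Sum>\<kappa>\<in>offspring_functions n. f \<kappa> * pmf (tree n) \<kappa>)"
proof (rule integral_measure_pmf_real[OF finite_offspring_functions])
  fix \<kappa> assume "\<kappa> \<in> set_pmf (tree n)"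
  then show "\<kappa> \<in> offspring_functions n"
    using supp by (auto simp: tree_def offspring_of_def set_Pi_pmf finite_words_below offspring_functions_def PiE_dflt_def)
qed

lemma prob_K_eq_pmf_tree:
  assumes "\<kappa> \<in> offspring_functions n"
  shows "prob {\<omega> \<in> space M. \<forall>v\<in>words_below m n. K v \<omega> = \<kappa> v} = pmf (tree n) \<kappa>"
proof -
  let ?V = "words_below m n"
  have "prob (K v -` {k} \<inter> space M) = pmf G k" for v k
  proof -
    have "prob (K v -` {k} \<inter> space M) = measure (distr M (count_space UNIV) (K v)) {k}"
      using K_measurable by (subst measure_distr) auto
    then show ?thesis by (simp add: K_distr measure_pmf_single)
  qed
  then have "prob {\<omega> \<in> space M. \<forall>v\<in>?V. K v \<omega> = \<kappa> v} = (\<Prod>v\<in>?V. pmf G (\<kappa> v))"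
  proof (cases "?V = {}")
    case False
    have "{\<omega> \<in> space M. \<forall>v\<in>?V. K v \<omega> = \<kappa> v} = (\<Inter>v\<in>?V. K v -` {\<kappa> v} \<inter> space M)"
      using False by auto
    also have "prob \<dots> = (\<Prod>v\<in>?V. prob (K v -` {\<kappa> v} \<inter> space M))"
      using False by (intro indep_varsD[OF K_indep] finite_words_below) auto
    finally show ?thesis using \<open>\<And>v k. prob (K v -` {k} \<inter> space M) = pmf G k\<close> by simp
  qed (simp add: prob_space)
  also have "\<dots> = pmf (tree n) \<kappa>"
    using assms unfolding tree_def offspring_of_def
    by (intro pmf_Pi'[symmetric] finite_words_below) (auto simp: offspring_functions_def PiE_dflt_def)
  finally show ?thesis .
qed

definition selections :: "nat \<Rightarrow> (nat list \<Rightarrow> nat) \<Rightarrow> (nat list \<Rightarrow> (nat \<Rightarrow> real) measure) set" where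
  "selections n \<kappa> = PiE (words_below m n) (\<lambda>v. F (\<kappa> v))"

lemma finite_selections: "\<kappa> \<in> offspring_functions n \<Longrightarrow> finite (selections n \<kappa>)"
  unfolding selections_def
  by (intro finite_PiE finite_words_below F_finite) (auto simp: offspring_functions_def PiE_dflt_def)

lemma sum_prob_history_le:
  assumes \<kappa>: "\<kappa> \<in> offspring_functions n"
  shows "(\<Sum>\<delta>\<in>selections n \<kappa>. prob (history (words_below m n) \<kappa> \<delta>)) \<le> pmf (tree n) \<kappa>"
proof -
  let ?V = "words_below m n"
  have "(\<Sum>\<delta>\<in>selections n \<kappa>. prob (history ?V \<kappa> \<delta>)) = prob (\<Union>\<delta>\<in>selections n \<kappa>. history ?V \<kappa> \<delta>)"
  proof (rule finite_measure_finite_Union[symmetric, OF finite_selections[OF \<kappa>]])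
    show "disjoint_family_on (history ?V \<kappa>) (selections n \<kappa>)"
      by (auto simp: disjoint_family_on_def history_def selections_def intro: PiE_ext)
  qed (auto intro: history_event finite_words_below)
  also have "\<dots> \<le> prob {\<omega> \<in> space M. \<forall>v\<in>?V. K v \<omega> = \<kappa> v}"
  proof (rule finite_measure_mono)
    note [measurable] = K_measurable
    show "{\<omega> \<in> space M. \<forall>v\<in>?V. K v \<omega> = \<kappa> v} \<in> events"
      by (intro sets.sets_Collect_finite_All finite_words_below) measurable
  qed (auto simp: history_def)
  finally show ?thesis by (simp add: prob_K_eq_pmf_tree \<kappa>)
qed

text \<open>This random variable equals almost surely the squared modulus of the average phase at level \<open>n\<close>.
  Since only finitely many histories occur up to level \<open>n\<close>, splitting according to them makes it
  evidently measurable, although the tree over which the phases are summed is itself random.\<close>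

definition mean_square :: "nat \<Rightarrow> 'w \<Rightarrow> real" where
  "mean_square n \<omega> = (\<Sum>\<kappa>\<in>offspring_functions n. \<Sum>\<delta>\<in>selections n \<kappa>.
      indicator (history (words_below m n) \<kappa> \<delta>) \<omega>
        * (norm (phase_sum n \<kappa> (\<lambda>u. cuts \<kappa> u \<omega>)))\<^sup>2 / (real (card (sticks \<kappa> n)))\<^sup>2)"

lemma mean_square_nonneg: "0 \<le> mean_square n \<omega>"
  unfolding mean_square_def by (intro sum_nonneg) auto

lemma history_range:
  assumes "\<kappa> \<in> offspring_functions n" "\<delta> \<in> selections n \<kappa>" "u \<in> words_below m n"
  shows "\<kappa> u \<in> {1..m} \<and> \<delta> u \<in> F (\<kappa> u)"
  using assms by (auto simp: offspring_functions_def selections_def PiE_dflt_def)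

lemma integrable_mean_square: "integrable M (mean_square n)"
  unfolding mean_square_def[abs_def]
  by (intro Bochner_Integration.integrable_sum Bochner_Integration.integrable_divide second_moment_history history_range)

lemma expectation_mean_square_le:
  "expectation (mean_square n) \<le> E (tree n) (\<lambda>\<kappa>. correlation (damping \<rho>) \<kappa> n)"
proof -
  let ?H = "history (words_below m n)" and ?N = "\<lambda>\<kappa>. (real (card (sticks \<kappa> n)))\<^sup>2"
  let ?s = "\<lambda>\<kappa> \<delta> \<omega>. indicator (?H \<kappa> \<delta>) \<omega> * (norm (phase_sum n \<kappa> (\<lambda>u. cuts \<kappa> u \<omega>)))\<^sup>2"
  have "expectation (mean_square n) = (\<Sum>\<kappa>\<in>offspring_functions n. \<Sum>\<delta>\<in>selections n \<kappa>. expectation (?s \<kappa> \<delta>) / ?N \<kappa>)"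
  proof -
    have "integrable M (?s \<kappa> \<delta>)" if "\<kappa> \<in> offspring_functions n" "\<delta> \<in> selections n \<kappa>" for \<kappa> \<delta>
      by (rule second_moment_history(1)[OF history_range[OF that]])
    then show ?thesis
      unfolding mean_square_def[abs_def] by (simp add: Bochner_Integration.integral_sum)
  qed
  also have "\<dots> \<le> (\<Sum>\<kappa>\<in>offspring_functions n. \<Sum>\<delta>\<in>selections n \<kappa>. prob (?H \<kappa> \<delta>) * total_weight (damping \<rho>) \<kappa> n / ?N \<kappa>)"
    by (intro sum_mono divide_right_mono second_moment_history(2) history_range) auto
  also have "\<dots> = (\<Sum>\<kappa>\<in>offspring_functions n. correlation (damping \<rho>) \<kappa> n * (\<Sum>\<delta>\<in>selections n \<kappa>. prob (?H \<kappa> \<delta>)))"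
    by (simp add: correlation_def sum_distrib_left mult.commute)
  also have "\<dots> \<le> (\<Sum>\<kappa>\<in>offspring_functions n. correlation (damping \<rho>) \<kappa> n * pmf (tree n) \<kappa>)"
    using correlation_bounds[of "damping \<rho>", OF damping_bounds]
    by (intro sum_mono mult_left_mono sum_prob_history_le) auto
  finally show ?thesis by (simp add: expectation_tree_eq_sum)
qed

text \<open>By monotone convergence the expectation of the series is finite.\<close>

lemma AE_summable_mean_square: "AE \<omega> in M. summable (\<lambda>n. mean_square n \<omega>)"
proof -
  let ?e = "\<lambda>n. E (tree n) (\<lambda>\<kappa>. correlation (damping \<rho>) \<kappa> n)"
  have e0: "0 \<le> ?e n" for n
    using correlation_bounds[of "damping \<rho>", OF damping_bounds] by (intro Bochner_Integration.integral_nonneg) auto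
  have [measurable]: "mean_square n \<in> borel_measurable M" for n
    using integrable_mean_square by (rule borel_measurable_integrable)
  have "(\<integral>\<^sup>+\<omega>. (\<Sum>n. ennreal (mean_square n \<omega>)) \<partial>M) = (\<Sum>n. \<integral>\<^sup>+\<omega>. ennreal (mean_square n \<omega>) \<partial>M)"
    by (rule nn_integral_suminf) measurable
  also have "\<dots> = (\<Sum>n. ennreal (expectation (mean_square n)))"
    by (simp add: nn_integral_eq_integral integrable_mean_square mean_square_nonneg)
  also have "\<dots> \<le> (\<Sum>n. ennreal (?e n))"
    by (intro suminf_le ennreal_leI expectation_mean_square_le) auto
  also have "\<dots> = ennreal (suminf ?e)"
    by (rule suminf_ennreal2[OF e0 summable_expectation_correlation])
  finally have "(\<integral>\<^sup>+\<omega>. (\<Sum>n. ennreal (mean_square n \<omega>)) \<partial>M) \<noteq> \<infinity>"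
    by (auto simp: top_unique)
  then have "AE \<omega> in M. (\<Sum>n. ennreal (mean_square n \<omega>)) \<noteq> \<infinity>"
    by (intro nn_integral_noteq_infinite) measurable
  then show ?thesis
    by eventually_elim (auto intro: summable_suminf_not_top mean_square_nonneg)
qed

end

section \<open>Almost sure convergence\<close>

context stick_breaking
begin

lemma AE_K_range:
  assumes "set_pmf G \<subseteq> {1..m}"
  shows "AE \<omega> in M. \<forall>v. K v \<omega> \<in> {1..m}"
proof -
  have "AE \<omega> in M. K v \<omega> \<in> {1..m}" for v
  proof -
    have "AE k in measure_pmf G. k \<in> {1..m}" using assms by (auto simp: AE_measure_pmf_iff)
    then have "AE k in distr M (count_space UNIV) (K v). k \<in> {1..m}" by (simp only: K_distr)
    then show ?thesis by (rule AE_distrD[OF K_measurable])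
  qed
  then show ?thesis by (simp add: AE_all_countable)
qed

text \<open>For each stick there are finitely many possible selections, and each of them puts no mass on cut
  vectors with a gap \<open>\<le> 0\<close>.\<close>

lemma AE_gap_pos:
  assumes G: "set_pmf G \<subseteq> {1..m}" and fin: "\<And>k. k \<in> {1..m} \<Longrightarrow> finite (F k)"
    and good: "\<And>k P. k \<in> {1..m} \<Longrightarrow> P \<in> F k \<Longrightarrow> good_distribution (k - 1) P"
  shows "AE \<omega> in M. \<forall>v. \<forall>i < K v \<omega>. 0 < gap (K v \<omega> - 1) (X v \<omega>) i"
proof -
  have conditional: "AE \<omega> in M. K v \<omega> = k \<and> D v \<omega> = P \<longrightarrow> (\<forall>i < k. 0 < gap (k - 1) (X v \<omega>) i)"
    if k: "k \<in> {1..m}" and P: "P \<in> F k" for v k P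
  proof -
    interpret P: prob_space P using good[OF k P] by (rule good_distribution_prob_space)
    define A where "A = {y \<in> space P. \<exists>i<k. gap (k - 1) y i \<le> 0}"
    have gm: "(\<lambda>y. gap (k - 1) y i) \<in> borel_measurable P" if "i < k" for i
      using that by (intro good_distribution_gap_measurable[OF good[OF k P]]) simp
    have "A = (\<Union>i\<in>{..<k}. {y \<in> space P. gap (k - 1) y i \<le> 0})"
      by (auto simp: A_def)
    also have "\<dots> \<in> sets P"
      by (intro sets.finite_UN borel_measurable_le[OF gm borel_measurable_const]) auto
    finally have Am: "A \<in> sets P" .
    have "AE y in P. \<forall>i<k. 0 < gap (k - 1) y i"
      by (intro AE_all_countable[THEN iffD2] allI AE_impI)
         (rule good_distribution_gap_pos[OF good[OF k P]], simp)
    then have "AE y in P. y \<notin> A" by eventually_elim (auto simp: A_def not_less)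
    then have A0: "measure P A = 0" using Am by (simp add: P.prob_eq_0)
    let ?B = "{\<omega> \<in> space M. \<forall>u\<in>{v}. K u \<omega> = k \<and> D u \<omega> = P \<and> restrict (X u \<omega>) {..<k - 1} \<in> A}"
    have B0: "prob ?B = 0"
      using X_conditional[of "{v}" "\<lambda>_. P" "\<lambda>_. k" "\<lambda>_. A"] P Am A0 by simp
    have cm: "cuts (\<lambda>_. k) v \<in> measurable M P"
      by (rule cuts_measurable) (use good_distribution_sets[OF good[OF k P]] in simp)
    have "?B = history {v} (\<lambda>_. k) (\<lambda>_. P) \<inter> (cuts (\<lambda>_. k) v -` A \<inter> space M)"
      by (auto simp: history_def cuts_def)
    then have "?B \<in> events"
      using history_event[of "{v}" "\<lambda>_. k" "\<lambda>_. P"] measurable_sets[OF cm Am] by auto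
    then have "AE \<omega> in M. \<omega> \<notin> ?B" using B0 prob_eq_0 by blast
    moreover have "AE \<omega> in M. \<omega> \<in> space M" by (rule AE_space)
    ultimately show ?thesis
    proof eventually_elim
      case (elim \<omega>)
      have "cuts (\<lambda>_. k) v \<omega> \<in> space P" using cm elim(2) by (rule measurable_space)
      then have "\<not> (\<exists>i<k. gap (k - 1) (cuts (\<lambda>_. k) v \<omega>) i \<le> 0)"
        if "K v \<omega> = k \<and> D v \<omega> = P"
        using elim that by (auto simp: A_def cuts_def)
      then show ?case by (simp add: cuts_def gap_restrict not_le)
    qed
  qed
  have "AE \<omega> in M. \<forall>k\<in>{1..m}. \<forall>P\<in>F k. K v \<omega> = k \<and> D v \<omega> = P \<longrightarrow> (\<forall>i < k. 0 < gap (k - 1) (X v \<omega>) i)" for v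
    by (intro AE_finite_allI finite_atLeastAtMost fin conditional)
  then have "AE \<omega> in M. \<forall>v. \<forall>k\<in>{1..m}. \<forall>P\<in>F k. K v \<omega> = k \<and> D v \<omega> = P \<longrightarrow> (\<forall>i < k. 0 < gap (k - 1) (X v \<omega>) i)"
    by (intro AE_all_countable[THEN iffD2] allI)
  with AE_K_range[OF G] D_selected show ?thesis
  proof eventually_elim
    case (elim \<omega>)
    show ?case
    proof (intro allI impI)
      fix v i assume i: "i < K v \<omega>"
      have "K v \<omega> \<in> {1..m}" "D v \<omega> \<in> F (K v \<omega>)" using elim(1,2) by auto
      then show "0 < gap (K v \<omega> - 1) (X v \<omega>) i" using elim(3) i by blast
    qed
  qed
qed

end

context stick_bounds
begin

lemma AE_phase_average_tendsto_0:
  "AE \<omega> in M. (\<lambda>n. phase_sum n (\<lambda>v. K v \<omega>) (\<lambda>v. X v \<omega>) / of_nat (card (sticks (\<lambda>v. K v \<omega>) n))) \<longlonglongrightarrow> 0"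
  using AE_summable_mean_square AE_K_range[OF supp] D_selected AE_space[of M]
proof eventually_elim
  case (elim \<omega>)
  let ?K = "\<lambda>v. K v \<omega>" and ?X = "\<lambda>v. X v \<omega>"
  let ?a = "\<lambda>n. phase_sum n ?K ?X / of_nat (card (sticks ?K n))"
  have "(norm (?a n))\<^sup>2 \<le> mean_square n \<omega>" for n
  proof -
    let ?V = "words_below m n"
    \<comment> \<open>The history realised by \<open>\<omega>\<close> contributes one term to \<open>mean_square\<close>.\<close>
    define \<kappa> where "\<kappa> = (\<lambda>v. if v \<in> ?V then K v \<omega> else 1)"
    define \<delta> where "\<delta> = restrict (\<lambda>v. D v \<omega>) ?V"
    have \<kappa>: "\<kappa> \<in> offspring_functions n"
      using elim(2) by (auto simp: \<kappa>_def offspring_functions_def PiE_dflt_def)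
    have \<delta>: "\<delta> \<in> selections n \<kappa>"
      using elim(3) by (auto simp: \<kappa>_def \<delta>_def selections_def)
    have \<omega>: "\<omega> \<in> history ?V \<kappa> \<delta>"
      using elim(4) by (auto simp: history_def \<kappa>_def \<delta>_def)
    have sticks: "sticks \<kappa> n = sticks ?K n"
      using elim(2) by (intro sticks_cong[of m]) (auto simp: \<kappa>_def)
    have sub: "sticks ?K n \<subseteq> words m n"
      using elim(2) by (intro sticks_subset_words) auto
    have "phase \<theta> \<kappa> (\<lambda>u. cuts \<kappa> u \<omega>) v = phase \<theta> ?K ?X v" if "v \<in> sticks ?K n" for v
      using that sub by (intro phase_cong[of _ m n]) (auto simp: \<kappa>_def cuts_def)
    then have ps: "phase_sum n \<kappa> (\<lambda>u. cuts \<kappa> u \<omega>) = phase_sum n ?K ?X"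
      by (simp add: phase_sum_def sticks)
    define t where "t = (\<lambda>\<kappa> \<delta>. indicator (history ?V \<kappa> \<delta>) \<omega>
        * (norm (phase_sum n \<kappa> (\<lambda>u. cuts \<kappa> u \<omega>)))\<^sup>2 / (real (card (sticks \<kappa> n)))\<^sup>2)"
    have t0: "0 \<le> t \<kappa>' \<delta>'" for \<kappa>' \<delta>' by (simp add: t_def)
    have "(norm (?a n))\<^sup>2 = t \<kappa> \<delta>"
      using \<omega> by (simp add: t_def ps sticks norm_divide power_divide)
    moreover have "t \<kappa> \<delta> \<le> sum (t \<kappa>) (selections n \<kappa>)"
      by (intro member_le_sum \<delta> t0 finite_selections \<kappa>)
    moreover have "sum (t \<kappa>) (selections n \<kappa>) \<le> (\<Sum>\<kappa>\<in>offspring_functions n. sum (t \<kappa>) (selections n \<kappa>))"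
      by (rule member_le_sum[OF \<kappa>, where f = "\<lambda>\<kappa>. sum (t \<kappa>) (selections n \<kappa>)"])
         (intro sum_nonneg t0 finite_offspring_functions)+
    moreover have "mean_square n \<omega> = (\<Sum>\<kappa>\<in>offspring_functions n. sum (t \<kappa>) (selections n \<kappa>))"
      by (simp only: mean_square_def t_def)
    ultimately show ?thesis by linarith
  qed
  then have "(\<lambda>n. (norm (?a n))\<^sup>2) \<longlonglongrightarrow> 0"
    by (intro Lim_null_comparison[OF _ summable_LIMSEQ_zero[OF elim(1)]] always_eventually allI) simp
  then have "(\<lambda>n. norm (?a n)) \<longlonglongrightarrow> 0"
    using tendsto_real_sqrt[of "\<lambda>n. (norm (?a n))\<^sup>2" 0] by simp
  then show ?case by (rule tendsto_norm_zero_cancel)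
qed

end

lemma osc_stick_length:
  assumes L: "0 < L" and pos: "\<And>v i. i < \<kappa> v \<Longrightarrow> 0 < gap (\<kappa> v - 1) (x v) i"
    and v: "v \<in> sticks \<kappa> n"
  shows "0 < stick_length L \<kappa> x v \<and> osc \<theta> (stick_length L \<kappa> x v) = osc \<theta> L * phase \<theta> \<kappa> x v"
  using v
proof (induction n arbitrary: v)
  case (Suc n)
  then obtain i w where "v = i # w" "w \<in> sticks \<kappa> n" "i < \<kappa> w" by auto
  then show ?case using Suc.IH[of w] pos[of i w] by (simp add: osc_mult)
qed (simp add: L)

theorem theorem1p6:
  fixes B L :: real and m :: nat and G :: "nat pmf"
    and F :: "nat \<Rightarrow> (nat \<Rightarrow> real) measure set"
    and M :: "'w measure"
    and K :: "nat list \<Rightarrow> 'w \<Rightarrow> nat"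
    and D :: "nat list \<Rightarrow> 'w \<Rightarrow> (nat \<Rightarrow> real) measure"
    and X :: "nat list \<Rightarrow> 'w \<Rightarrow> nat \<Rightarrow> real"
  assumes "1 < B" and "0 < L"
    and "set_pmf G \<subseteq> {1..m}" and "pmf G 1 < 1"
    and "\<And>k. k \<in> {1..m} \<Longrightarrow> finite (F k)"
    and "\<And>k P. k \<in> {1..m} \<Longrightarrow> P \<in> F k \<Longrightarrow>
           good_distribution (k - 1) P \<and> has_density_on_cube (k - 1) P"
    and "stick_breaking M G F K D X"
  shows "AE \<omega> in M. strong_benford B (stick_lengths L (\<lambda>v. K v \<omega>) (\<lambda>v. X v \<omega>))"
proof -
  interpret stick_breaking M G F K D X by fact
  have good: "good_distribution (k - 1) P" if "k \<in> {1..m}" "P \<in> F k" for k P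
    using assms(6) that by blast
  let ?\<theta> = "\<lambda>h::int. 2 * pi * of_int h / ln B"
  let ?avg = "\<lambda>h \<omega> n. (\<Sum>v\<in>sticks (\<lambda>v. K v \<omega>) n. phase (?\<theta> h) (\<lambda>v. K v \<omega>) (\<lambda>v. X v \<omega>) v)
      / of_nat (card (sticks (\<lambda>v. K v \<omega>) n))"
  have "AE \<omega> in M. ?avg h \<omega> \<longlonglongrightarrow> 0" if h: "h \<noteq> 0" for h
  proof -
    have \<theta>: "?\<theta> h \<noteq> 0" using h assms(1) by simp
    have "\<exists>\<rho>. 0 \<le> \<rho> \<and> \<rho> < 1 \<and>
        (\<forall>k\<in>{2..m}. \<forall>P\<in>F k. \<forall>i<k. norm (\<integral>y. osc (?\<theta> h) (gap (k - 1) y i) \<partial>P) \<le> \<rho>)"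
      by (rule uniform_oscillation_bound; fact)
    then obtain \<rho> where \<rho>: "0 \<le> \<rho>" "\<rho> < 1"
      "\<forall>k\<in>{2..m}. \<forall>P\<in>F k. \<forall>i<k. norm (\<integral>y. osc (?\<theta> h) (gap (k - 1) y i) \<partial>P) \<le> \<rho>"
      by (elim exE conjE)
    interpret stick_bounds M G F K D X m \<rho> "?\<theta> h"
      by unfold_locales (use assms \<rho> good in auto)
    show ?thesis using AE_phase_average_tendsto_0 by (simp add: phase_sum_def)
  qed
  then have "AE \<omega> in M. \<forall>h. h \<noteq> 0 \<longrightarrow> ?avg h \<omega> \<longlonglongrightarrow> 0"
    by (intro AE_all_countable[THEN iffD2] allI AE_impI)
  moreover have "AE \<omega> in M. \<forall>v. \<forall>i < K v \<omega>. 0 < gap (K v \<omega> - 1) (X v \<omega>) i"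
    by (rule AE_gap_pos; fact)
  moreover have "AE \<omega> in M. \<forall>v. K v \<omega> \<in> {1..m}"
    by (rule AE_K_range) fact
  ultimately show ?thesis
  proof eventually_elim
    case (elim \<omega>)
    let ?K = "\<lambda>v. K v \<omega>" and ?X = "\<lambda>v. X v \<omega>"
    let ?len = "stick_length L ?K ?X"
    have len: "0 < ?len v \<and> osc \<theta> (?len v) = osc \<theta> L * phase \<theta> ?K ?X v" if "v \<in> sticks ?K n" for v n \<theta>
      using elim(2) by (intro osc_stick_length[OF assms(2) _ that]) auto
    show ?case
    proof (rule strong_benford_criterion[OF assms(1)])
      show "stick_lengths L ?K ?X n \<noteq> {#}" for n
        using sticks_nonempty[of m n ?K] elim(3) finite_sticks by (simp add: stick_lengths_def mset_set_empty_iff)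
      show "0 < x" if "x \<in># stick_lengths L ?K ?X n" for n x
        using that len finite_sticks by (auto simp: stick_lengths_def)
      fix h :: int assume h: "h \<noteq> 0"
      have "(\<Sum>x\<in>#stick_lengths L ?K ?X n. cis (?\<theta> h * ln x)) / of_nat (size (stick_lengths L ?K ?X n))
          = osc (?\<theta> h) L * ?avg h \<omega> n" for n
      proof -
        have "(\<Sum>x\<in>#stick_lengths L ?K ?X n. cis (?\<theta> h * ln x)) = (\<Sum>v\<in>sticks ?K n. osc (?\<theta> h) (?len v))"
          by (simp add: stick_lengths_def multiset.map_comp o_def osc_def sum_unfold_sum_mset)
        also have "\<dots> = osc (?\<theta> h) L * (\<Sum>v\<in>sticks ?K n. phase (?\<theta> h) ?K ?X v)"
          unfolding sum_distrib_left by (intro sum.cong refl) (use len in blast)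
        finally show ?thesis by (simp add: stick_lengths_def)
      qed
      moreover have "(\<lambda>n. osc (?\<theta> h) L * ?avg h \<omega> n) \<longlonglongrightarrow> osc (?\<theta> h) L * 0"
        using elim(1) h by (intro tendsto_mult_left) blast
      ultimately show "(\<lambda>n. (\<Sum>x\<in>#stick_lengths L ?K ?X n. cis (?\<theta> h * ln x))
          / of_nat (size (stick_lengths L ?K ?X n))) \<longlonglongrightarrow> 0"
        by simp
    qed
  qed
qed

end
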